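(* For any $A\subseteq\omega$ there is an $A'$-computable perfect tree $T$ such that for any nonempty finite collection $\mathcal{F}$ of (pairwise distinct) paths through $T$, the join $\bigoplus_{Y\in\mathcal{F}}Y$ is $1$-random relative to $A$; hence the joins of any two finite, disjoint, nonempty collections of paths through $T$ are mutually $1$-random relative to $A$.
   Context: A perfect tree is a map $T:2^{<\omega}\to 2^{<\omega}$ such that for each $\sigma$, the strings $T(\sigma^\frown0)$ and $T(\sigma^\frown1)$ are incompatible and both properly extend $T(\sigma)$; for $X\in 2^\omega$, $T(X)=\bigcup_{\sigma\prec X}T(\sigma)$, and $Y$ is a path through $T$ if $Y=T(X)$ for some $X$. For sets $X_0,\dots,X_n$, $\bigoplus_{i\le n}X_i$ is the set whose characteristic sequence is $X_0(0)\cdots X_n(0)X_0(1)\cdots X_n(1)\cdots$ (the elements of $\mathcal{F}$ being listed in some order). "$1$-random relative to $A$" means Martin-Löf random relative to $A$; $X,Y$ are mutually $1$-random relative to $A$ if $X\oplus Y$ is $1$-random relative to $A$. *)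

theory Defs
  imports "HOL-Probability.Probability" "HOL-Library.Nat_Bijection" "HOL-Library.Sublist"
begin

section \<open>Relative computation\<close>

text \<open>
  Programs for the partial recursive functions relative to a set \<open>A\<close>. All functions are unary;
  tuples are passed through the bijective Cantor pairing \<^const>\<open>prod_encode\<close>.
  The identity is \<open>Tup Fst Snd\<close>.
\<close>

datatype code = Zero | Succ | Fst | Snd | Query
  | Tup code code | Comp code code | Prec code code | Mu code

text \<open>\<open>runs A c x y\<close>: program \<open>c\<close>, querying \<open>A\<close>, halts on input \<open>x\<close> with output \<open>y\<close>.\<close>

inductive runs :: "nat set \<Rightarrow> code \<Rightarrow> nat \<Rightarrow> nat \<Rightarrow> bool" for A where
  zero: "runs A Zero x 0"
| succ: "runs A Succ x (Suc x)"
| fst: "runs A Fst (prod_encode (x, y)) x"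
| snd: "runs A Snd (prod_encode (x, y)) y"
| query: "runs A Query x (of_bool (x \<in> A))"
| tup: "runs A f x y \<Longrightarrow> runs A g x z \<Longrightarrow> runs A (Tup f g) x (prod_encode (y, z))"
| comp: "runs A g x y \<Longrightarrow> runs A f y z \<Longrightarrow> runs A (Comp f g) x z"
| prec_0: "runs A f x y \<Longrightarrow> runs A (Prec f g) (prod_encode (x, 0)) y"
| prec_Suc: "runs A (Prec f g) (prod_encode (x, n)) y \<Longrightarrow>
    runs A g (prod_encode (x, prod_encode (n, y))) z \<Longrightarrow>
    runs A (Prec f g) (prod_encode (x, Suc n)) z"
| mu: "runs A f (prod_encode (x, n)) 0 \<Longrightarrow>
    (\<And>m. m < n \<Longrightarrow> \<exists>y. runs A f (prod_encode (x, m)) (Suc y)) \<Longrightarrow>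
    runs A (Mu f) x n"

fun goedel :: "code \<Rightarrow> nat" where
  "goedel Zero = prod_encode (0, 0)"
| "goedel Succ = prod_encode (1, 0)"
| "goedel Fst = prod_encode (2, 0)"
| "goedel Snd = prod_encode (3, 0)"
| "goedel Query = prod_encode (4, 0)"
| "goedel (Tup f g) = prod_encode (5, prod_encode (goedel f, goedel g))"
| "goedel (Comp f g) = prod_encode (6, prod_encode (goedel f, goedel g))"
| "goedel (Prec f g) = prod_encode (7, prod_encode (goedel f, goedel g))"
| "goedel (Mu f) = prod_encode (8, goedel f)"

lemma inj_goedel: "inj goedel"
proof (rule injI)
  fix c d show "goedel c = goedel d \<Longrightarrow> c = d"
    by (induction c arbitrary: d) (case_tac d; auto)+
qed

inductive_cases runsE:
  "runs A Zero x y" "runs A Succ x y" "runs A Fst x y" "runs A Snd x y" "runs A Query x y"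
  "runs A (Tup f g) x y" "runs A (Comp f g) x y"
  "runs A (Prec f g) (prod_encode (x, 0)) y" "runs A (Prec f g) (prod_encode (x, Suc n)) y"
  "runs A (Mu f) x y"

lemma runs_deterministic: "runs A c x y \<Longrightarrow> runs A c x z \<Longrightarrow> y = z"
proof (induction arbitrary: z rule: runs.induct)
  case (mu f x n)
  from mu.prems obtain 0: "runs A f (prod_encode (x, z)) 0"
    and S: "\<And>m. m < z \<Longrightarrow> \<exists>y. runs A f (prod_encode (x, m)) (Suc y)"
    by (rule runsE(10)) blast
  show ?case
  proof (rule linorder_cases[of n z])
    assume "n < z"
    with S mu.IH(1) show ?thesis by (metis nat.distinct(1))
  next
    assume "z < n"
    with 0 mu.IH(2) show ?thesis by (metis nat.distinct(1))
  qed simp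
next
  case (fst x y) then show ?case by (auto elim!: runsE(3))
next
  case (snd x y) then show ?case by (auto elim!: runsE(4))
next
  case (tup f x y g w) from tup.prems tup.IH show ?case by (auto elim!: runsE(6))
next
  case (comp g x y f w) from comp.prems comp.IH show ?case by (auto elim!: runsE(7))
next
  case (prec_0 f x y g) from prec_0.prems prec_0.IH show ?case by (auto elim!: runsE(8))
next
  case (prec_Suc f g x n y w)
  from prec_Suc.prems obtain v where v: "runs A (Prec f g) (prod_encode (x, n)) v"
    "runs A g (prod_encode (x, prod_encode (n, v))) z" by (auto elim!: runsE(9))
  with prec_Suc.IH show ?case by blast
qed (auto elim: runsE)

text \<open>
  The halting set of the numbering \<open>goedel\<close> relative to \<open>A\<close>. Numbers that are not indices of
  programs count as indices of the nowhere defined function.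
\<close>

definition jump :: "nat set \<Rightarrow> nat set" where
  "jump A = {goedel c | c. \<exists>y. runs A c (goedel c) y}"


section \<open>Strings and Cantor space\<close>

definition str_code :: "bool list \<Rightarrow> nat" where
  "str_code \<sigma> = list_encode (map of_bool \<sigma>)"

definition initseg :: "(nat \<Rightarrow> bool) \<Rightarrow> nat \<Rightarrow> bool list" where
  "initseg X k = map X [0..<k]"

text \<open>The fair coin measure.\<close>

definition cantor_measure :: "(nat \<Rightarrow> bool) measure" where
  "cantor_measure = PiM UNIV (\<lambda>_. measure_pmf (bernoulli_pmf (1 / 2)))"

text \<open>\<open>\<Oplus>\<^sub>i\<^sub>\<le>\<^sub>n X\<^sub>i\<close> for the nonempty list \<open>[X\<^sub>0, \<dots>, X\<^sub>n]\<close>.\<close>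

definition seq_join :: "(nat \<Rightarrow> bool) list \<Rightarrow> nat \<Rightarrow> bool" where
  "seq_join Xs = (\<lambda>m. (Xs ! (m mod length Xs)) (m div length Xs))"


section \<open>Randomness\<close>

text \<open>
  A \<open>\<Sigma>\<^sup>0\<^sub>1\<close> class relative to \<open>A\<close> has the form \<open>{X. \<exists>k. R (X \<restriction> k)}\<close> with \<open>R\<close> an \<open>A\<close>-computable
  set of strings; uniformity in \<open>n\<close> means that \<open>R n \<sigma>\<close> is decided by one program.
\<close>

definition uniformly_Sigma1 :: "nat set \<Rightarrow> (nat \<Rightarrow> (nat \<Rightarrow> bool) set) \<Rightarrow> bool" where
  "uniformly_Sigma1 A U \<longleftrightarrow> (\<exists>R :: nat \<Rightarrow> bool list \<Rightarrow> bool.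
     (\<exists>c. \<forall>n \<sigma>. runs A c (prod_encode (n, str_code \<sigma>)) (of_bool (R n \<sigma>))) \<and>
     (\<forall>n. U n = {X. \<exists>k. R n (initseg X k)}))"

definition ml_test :: "nat set \<Rightarrow> (nat \<Rightarrow> (nat \<Rightarrow> bool) set) \<Rightarrow> bool" where
  "ml_test A U \<longleftrightarrow> uniformly_Sigma1 A U \<and> (\<forall>n. measure cantor_measure (U n) \<le> (1 / 2) ^ n)"

definition ml_random :: "nat set \<Rightarrow> (nat \<Rightarrow> bool) \<Rightarrow> bool" where
  "ml_random A X \<longleftrightarrow> (\<forall>U. ml_test A U \<longrightarrow> X \<notin> (\<Inter>n. U n))"

definition mutually_ml_random :: "nat set \<Rightarrow> (nat \<Rightarrow> bool) \<Rightarrow> (nat \<Rightarrow> bool) \<Rightarrow> bool" where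
  "mutually_ml_random A X Y \<longleftrightarrow> ml_random A (seq_join [X, Y])"


section \<open>Perfect trees\<close>

definition perfect_tree :: "(bool list \<Rightarrow> bool list) \<Rightarrow> bool" where
  "perfect_tree T \<longleftrightarrow> (\<forall>\<sigma>. T (\<sigma> @ [False]) \<parallel> T (\<sigma> @ [True]) \<and>
     strict_prefix (T \<sigma>) (T (\<sigma> @ [False])) \<and> strict_prefix (T \<sigma>) (T (\<sigma> @ [True])))"

definition computable_tree :: "nat set \<Rightarrow> (bool list \<Rightarrow> bool list) \<Rightarrow> bool" where
  "computable_tree B T \<longleftrightarrow> (\<exists>c. \<forall>\<sigma>. runs B c (str_code \<sigma>) (str_code (T \<sigma>)))"

text \<open>
  The union of the strings \<open>T (X \<restriction> n)\<close>: position \<open>k\<close> is 1 iff some of these strings has a 1 there.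
\<close>

definition tree_path :: "(bool list \<Rightarrow> bool list) \<Rightarrow> (nat \<Rightarrow> bool) \<Rightarrow> nat \<Rightarrow> bool" where
  "tree_path T X = (\<lambda>k. \<exists>n. k < length (T (initseg X n)) \<and> T (initseg X n) ! k)"

definition paths :: "(bool list \<Rightarrow> bool list) \<Rightarrow> (nat \<Rightarrow> bool) set" where
  "paths T = range (tree_path T)"

lemma perfect_tree_step:
  assumes "perfect_tree T"
  shows "strict_prefix (T \<sigma>) (T (\<sigma> @ [b]))"
proof (cases b)
  case True
  have "strict_prefix (T \<sigma>) (T (\<sigma> @ [True]))"
    using assms unfolding perfect_tree_def by blast
  with True show ?thesis by (simp only:)
next
  case False
  have "strict_prefix (T \<sigma>) (T (\<sigma> @ [False]))"
    using assms unfolding perfect_tree_def by blast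
  with False show ?thesis by (simp only:)
qed

lemma perfect_tree_mono:
  assumes "perfect_tree T" "m \<le> n"
  shows "prefix (T (initseg X m)) (T (initseg X n)) \<and>
    length (T (initseg X m)) + (n - m) \<le> length (T (initseg X n))"
  using assms(2)
proof (induction n rule: dec_induct)
  case base
  show ?case by simp
next
  case (step n)
  have "initseg X (Suc n) = initseg X n @ [X n]" by (simp add: initseg_def)
  then have *: "strict_prefix (T (initseg X n)) (T (initseg X (Suc n)))"
    using perfect_tree_step[OF assms(1), of "initseg X n" "X n"] by (simp only:)
  have "prefix (T (initseg X m)) (T (initseg X (Suc n)))"
    using step.IH * prefix_order.le_less_trans prefix_order.less_imp_le by blast
  moreover have "length (T (initseg X m)) + (Suc n - m) \<le> length (T (initseg X (Suc n)))"
    using step.IH step.hyps prefix_length_less[OF *] by linarith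
  ultimately show ?case by blast
qed

text \<open>For a perfect tree, \<open>tree_path T X\<close> is the sequence extending every \<open>T (X \<restriction> n)\<close>.\<close>

lemma initseg_tree_path:
  assumes "perfect_tree T"
  shows "initseg (tree_path T X) (length (T (initseg X n))) = T (initseg X n)"
proof (rule nth_equalityI)
  fix k assume k: "k < length (initseg (tree_path T X) (length (T (initseg X n))))"
  then have kn: "k < length (T (initseg X n))" by (simp add: initseg_def)
  have "T (initseg X m) ! k = T (initseg X n) ! k" if km: "k < length (T (initseg X m))" for m
  proof (cases "m \<le> n")
    case True
    then obtain zs where "T (initseg X n) = T (initseg X m) @ zs"
      using perfect_tree_mono[OF assms True, of X] by (auto elim: prefixE)
    with km show ?thesis by (simp add: nth_append)
  next
    case False
    then obtain zs where "T (initseg X m) = T (initseg X n) @ zs"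
      using perfect_tree_mono[OF assms, of n m X] by (auto elim: prefixE)
    with kn show ?thesis by (simp add: nth_append)
  qed
  with kn have "tree_path T X k = T (initseg X n) ! k" unfolding tree_path_def by blast
  with kn show "initseg (tree_path T X) (length (T (initseg X n))) ! k = T (initseg X n) ! k"
    by (simp add: initseg_def)
qed (simp add: initseg_def)

end

theory Submission
  imports Defs
begin

text \<open>
  The tree is built in stages. At stage \<open>N\<close> there are \<open>N\<close> strings of equal length and a closed set of
  \<open>N\<close>-tuples of sequences, effective relative to \<open>A\<close>, whose conditional measure above the strings is at
  least \<open>2 ^ -r\<close>. One string is doubled at each stage: the tuples all of whose choices of copies
  lie in the closed set have measure at least \<open>2 ^ -2r\<close> by Cauchy-Schwarz. An averaging argument
  then lengthens the strings so that the two copies become incompatible, at the cost of one more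
  bit. Before each doubling one more test component is removed from the closed set if at most half
  of the measure is lost. A genuine Martin-Loef test passes, since the component can be taken of
  very small measure, and it is tried at infinitely many stages, hence also after the given paths have
  separated. The questions asked are \<open>\<Pi>\<^sup>0\<^sub>1\<close> relative to \<open>A\<close>, so \<open>A'\<close> answers them. All measures are counted
  at finite levels, and a test is replaced by one decided without unbounded search, so that
  no universal machine is needed.
\<close>

section \<open>Primitive recursion relative to an oracle\<close>

text \<open>That a closed set effective in \<open>A\<close> has positive measure is an exists-forall
  question, out of reach of \<open>A'\<close>; a lower bound \<open>2 ^ -r\<close> fixed in advance
  leaves only the universal quantifier. Hence densities are tracked explicitly. One stage takes the
  exponent \<open>r\<close> to \<open>r + 1\<close> (test), \<open>2 * (r + 1)\<close> (doubling)
  and \<open>2 * (r + 1) + 1\<close> (separation), and separation wants at least as many new bits;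
  \<open>4 ^ N\<close> leaves room for both and serves as exponent and as length.

  A test is put in once and never revisited: the doubled closed set demands that every choice of
  copies lie in the old one, so all choices of later copies still avoid the test. As it is not known
  which strings the given paths use, a test for \<open>p\<close> sequences is tried on all injective
  choices of \<open>p\<close> of the \<open>N\<close> coordinates.

  Programs without \<open>Mu\<close> are total for every oracle. One calculus of such programs
  therefore serves three oracles: the decided open set in the questions, \<open>A\<close> in the
  tests, and \<open>A'\<close> in the construction.\<close>

fun mufree :: "code \<Rightarrow> bool" where
  "mufree (Tup f g) \<longleftrightarrow> mufree f \<and> mufree g"
| "mufree (Comp f g) \<longleftrightarrow> mufree f \<and> mufree g"
| "mufree (Prec f g) \<longleftrightarrow> mufree f \<and> mufree g"
| "mufree (Mu f) \<longleftrightarrow> False"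
| "mufree _ \<longleftrightarrow> True"

text \<open>The program is chosen before the oracle, so that the same program can be run with any
  set and also be used inside \<open>plug\<close>.\<close>

definition pr :: "(nat set \<Rightarrow> nat \<Rightarrow> nat) \<Rightarrow> bool" where
  "pr F \<longleftrightarrow> (\<exists>c. mufree c \<and> (\<forall>S x. runs S c x (F S x)))"

definition p1 :: "nat \<Rightarrow> nat" where "p1 z = fst (prod_decode z)"
definition p2 :: "nat \<Rightarrow> nat" where "p2 z = snd (prod_decode z)"

lemma p1_encode [simp]: "p1 (prod_encode (a, b)) = a"
  and p2_encode [simp]: "p2 (prod_encode (a, b)) = b"
  and encode_p1_p2 [simp]: "prod_encode (p1 z, p2 z) = z"
  by (simp_all add: p1_def p2_def)

lemma runs_Fst: "runs S Fst z (p1 z)" and runs_Snd: "runs S Snd z (p2 z)"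
  using runs.fst[where x = "p1 z" and y = "p2 z"] runs.snd[where x = "p1 z" and y = "p2 z"]
  by simp_all

lemma runs_Id: "runs S (Tup Fst Snd) z z"
  using runs.tup[OF runs_Fst runs_Snd, of S z] by simp

lemma runs_Prec:
  assumes "\<And>x. runs S f x (F x)" "\<And>x. runs S g x (G x)"
  shows "runs S (Prec f g) z
    (rec_nat (F (p1 z)) (\<lambda>n v. G (prod_encode (p1 z, prod_encode (n, v)))) (p2 z))"
proof -
  have "runs S (Prec f g) (prod_encode (x, n))
    (rec_nat (F x) (\<lambda>n v. G (prod_encode (x, prod_encode (n, v)))) n)" for x n
    by (induction n) (auto intro: runs.intros assms)
  from this[of "p1 z" "p2 z"] show ?thesis by simp
qed

lemma mufree_total: "mufree c \<Longrightarrow> \<exists>F. \<forall>x. runs S c x (F x)"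
proof (induction c)
  case (Tup f g)
  then obtain F G where "\<And>x. runs S f x (F x)" "\<And>x. runs S g x (G x)" by auto
  then show ?case by (intro exI[of _ "\<lambda>x. prod_encode (F x, G x)"]) (simp add: runs.tup)
next
  case (Comp f g)
  then obtain F G where "\<And>x. runs S f x (F x)" "\<And>x. runs S g x (G x)" by auto
  then show ?case by (intro exI[of _ "\<lambda>x. F (G x)"]) (blast intro: runs.comp)
next
  case (Prec f g)
  then obtain F G where "\<And>x. runs S f x (F x)" "\<And>x. runs S g x (G x)" by auto
  from runs_Prec[OF this] show ?case
    by (intro exI allI)
qed (auto intro: runs.intros runs_Fst runs_Snd)

fun numeral_code :: "nat \<Rightarrow> code" where
  "numeral_code 0 = Zero"
| "numeral_code (Suc n) = Comp Succ (numeral_code n)"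

lemma runs_numeral_code: "runs S (numeral_code n) x n"
  by (induction n) (auto intro: runs.intros)

lemma mufree_numeral_code [simp]: "mufree (numeral_code n)"
  by (induction n) auto

lemma pr_const: "pr (\<lambda>S x. n)"
  unfolding pr_def using runs_numeral_code mufree_numeral_code by blast

lemma pr_id: "pr (\<lambda>S x. x)"
  unfolding pr_def using runs_Id by (metis mufree.simps(1,7,8))

lemma pr_Suc: "pr F \<Longrightarrow> pr (\<lambda>S x. Suc (F S x))"
  unfolding pr_def by (metis mufree.simps(2,6) runs.comp runs.succ)

lemma pr_p1: "pr F \<Longrightarrow> pr (\<lambda>S x. p1 (F S x))"
  unfolding pr_def by (metis mufree.simps(2,7) runs.comp runs_Fst)

lemma pr_p2: "pr F \<Longrightarrow> pr (\<lambda>S x. p2 (F S x))"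
  unfolding pr_def by (metis mufree.simps(2,8) runs.comp runs_Snd)

lemma pr_query: "pr F \<Longrightarrow> pr (\<lambda>S x. of_bool (F S x \<in> S))"
  unfolding pr_def by (metis mufree.simps(2,9) runs.comp runs.query)

lemma pr_pair: "pr F \<Longrightarrow> pr G \<Longrightarrow> pr (\<lambda>S x. prod_encode (F S x, G S x))"
  unfolding pr_def by (metis mufree.simps(1) runs.tup)

lemma pr_comp: "pr G \<Longrightarrow> pr F \<Longrightarrow> pr (\<lambda>S x. G S (F S x))"
  unfolding pr_def by (metis mufree.simps(2) runs.comp)

text \<open>The rules for bounded sums, quantifiers and searches leave the body in the paired form
  \<open>G S (p1 z) (p2 z)\<close>; this substitutes arguments into such a body.\<close>

lemma pr_comp2:
  "pr (\<lambda>S z. G S (p1 z) (p2 z)) \<Longrightarrow> pr F \<Longrightarrow> pr H \<Longrightarrow> pr (\<lambda>S x. G S (F S x) (H S x))"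
  using pr_comp[of "\<lambda>S z. G S (p1 z) (p2 z)", OF _ pr_pair[of F H]] by simp

lemma pr_rec:
  assumes "pr Z" "pr (\<lambda>S z. T S (p1 z) (p1 (p2 z)) (p2 (p2 z)))" "pr N"
  shows "pr (\<lambda>S x. rec_nat (Z S x) (T S x) (N S x))"
proof -
  obtain f g where f: "mufree f" "\<And>S x. runs S f x (Z S x)"
    and g: "mufree g" "\<And>S z. runs S g z (T S (p1 z) (p1 (p2 z)) (p2 (p2 z)))"
    using assms(1,2) unfolding pr_def by blast
  have "runs S (Prec f g) z (rec_nat (Z S (p1 z)) (T S (p1 z)) (p2 z))" for S z
    using runs_Prec[of S f "Z S" g "\<lambda>z. T S (p1 z) (p1 (p2 z)) (p2 (p2 z))" z, OF f(2) g(2)] by simp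
  then have "pr (\<lambda>S z. rec_nat (Z S (p1 z)) (T S (p1 z)) (p2 z))"
    unfolding pr_def using f(1) g(1) by (metis mufree.simps(3))
  from pr_comp[OF this pr_pair[OF pr_id assms(3)]] show ?thesis by simp
qed

lemmas pr_basic = pr_const pr_id pr_Suc pr_p1 pr_p2 pr_query pr_pair

section \<open>Arithmetic, bounded quantifiers and bounded search\<close>

lemma pr_add: "pr F \<Longrightarrow> pr G \<Longrightarrow> pr (\<lambda>S x. F S x + G S x)"
proof -
  have "rec_nat a (\<lambda>_. Suc) n = a + n" for a n by (induction n) auto
  moreover assume "pr F" "pr G"
  then have "pr (\<lambda>S x. rec_nat (F S x) (\<lambda>_. Suc) (G S x))" by (intro pr_rec pr_basic)
  ultimately show ?thesis by simp
qed

lemma pr_diff: "pr F \<Longrightarrow> pr G \<Longrightarrow> pr (\<lambda>S x. F S x - G S x)"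
proof -
  have 1: "rec_nat 0 (\<lambda>n _. n) n = n - 1" for n :: nat by (cases n) auto
  have 2: "pr (\<lambda>S x. F S x - 1)" if "pr F" for F
    unfolding 1[symmetric] by (intro pr_rec pr_basic that)
  have "rec_nat a (\<lambda>_ v. v - 1) n = a - n" for a n :: nat by (induction n) auto
  moreover assume "pr F" "pr G"
  then have "pr (\<lambda>S x. rec_nat (F S x) (\<lambda>_ v. v - 1) (G S x))" by (intro pr_rec pr_basic 2)
  ultimately show ?thesis by (simp only:)
qed

lemma pr_mult: "pr F \<Longrightarrow> pr G \<Longrightarrow> pr (\<lambda>S x. F S x * G S x)"
proof -
  have "rec_nat 0 (\<lambda>_ v. v + a) n = a * n" for a n :: nat by (induction n) auto
  moreover assume "pr F" "pr G"
  then have "pr (\<lambda>S x. rec_nat 0 (\<lambda>_ v. v + F S x) (G S x))"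
    by (intro pr_rec pr_add pr_basic pr_comp[OF \<open>pr F\<close>])
  ultimately show ?thesis by (simp only:)
qed

lemma pr_power: "pr F \<Longrightarrow> pr G \<Longrightarrow> pr (\<lambda>S x. F S x ^ G S x)"
proof -
  have "rec_nat 1 (\<lambda>_ v. v * a) n = a ^ n" for a n :: nat by (induction n) auto
  moreover assume "pr F" "pr G"
  then have "pr (\<lambda>S x. rec_nat 1 (\<lambda>_ v. v * F S x) (G S x))"
    by (intro pr_rec pr_mult pr_basic pr_comp[OF \<open>pr F\<close>])
  ultimately show ?thesis by (simp only:)
qed

lemma pr_sum:
  assumes "pr (\<lambda>S z. f S (p1 z) (p2 z))" "pr N"
  shows "pr (\<lambda>S x. \<Sum>i<N S x. f S x i)"
proof -
  have eq: "rec_nat 0 (\<lambda>n v. v + h n) n = (\<Sum>i<n. h i)" for h n by (induction n) auto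
  have "pr (\<lambda>S z. p2 (p2 z) + f S (p1 z) (p1 (p2 z)))"
    by (intro pr_add pr_comp2[OF assms(1)] pr_basic)
  from pr_rec[of "\<lambda>_ _. 0" "\<lambda>S x n v. v + f S x n", OF pr_const this assms(2)] show ?thesis
    by (simp add: eq)
qed

lemma pr_le: "pr F \<Longrightarrow> pr G \<Longrightarrow> pr (\<lambda>S x. of_bool (F S x \<le> G S x))"
proof -
  have "of_bool (a \<le> b) = 1 - (a - b)" for a b :: nat by auto
  then show "pr F \<Longrightarrow> pr G \<Longrightarrow> ?thesis" by (simp only:) (intro pr_diff pr_const)
qed

lemma pr_less: "pr F \<Longrightarrow> pr G \<Longrightarrow> pr (\<lambda>S x. of_bool (F S x < G S x))"
  unfolding Suc_le_eq[symmetric] by (intro pr_le pr_Suc)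

lemma pr_not: "pr (\<lambda>S x. of_bool (P S x)) \<Longrightarrow> pr (\<lambda>S x. of_bool (\<not> P S x))"
proof -
  have "of_bool (\<not> b) = 1 - (of_bool b :: nat)" for b by simp
  then show "pr (\<lambda>S x. of_bool (P S x)) \<Longrightarrow> ?thesis" by (simp only:) (intro pr_diff pr_const)
qed

lemma pr_conj:
  "pr (\<lambda>S x. of_bool (P S x)) \<Longrightarrow> pr (\<lambda>S x. of_bool (Q S x)) \<Longrightarrow> pr (\<lambda>S x. of_bool (P S x \<and> Q S x))"
  unfolding of_bool_conj by (intro pr_mult)

lemma pr_disj:
  "pr (\<lambda>S x. of_bool (P S x)) \<Longrightarrow> pr (\<lambda>S x. of_bool (Q S x)) \<Longrightarrow> pr (\<lambda>S x. of_bool (P S x \<or> Q S x))"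
  using pr_not[OF pr_conj[OF pr_not pr_not], of P Q] by simp

lemma pr_eq: "pr F \<Longrightarrow> pr G \<Longrightarrow> pr (\<lambda>S x. of_bool (F S x = G S x))"
  unfolding eq_iff[of "_ :: nat"] by (intro pr_conj pr_le)

lemma pr_if:
  assumes "pr (\<lambda>S x. of_bool (P S x))" "pr F" "pr G"
  shows "pr (\<lambda>S x. if P S x then F S x else G S x)"
proof -
  have "(if P then a else b) = of_bool P * a + of_bool (\<not> P) * b" for P and a b :: nat by auto
  then show ?thesis by (simp only:) (intro pr_add pr_mult pr_not assms)
qed

lemma pr_ex:
  assumes "pr (\<lambda>S z. of_bool (P S (p1 z) (p2 z)))" "pr N"
  shows "pr (\<lambda>S x. of_bool (\<exists>i<N S x. P S x i))"
proof -
  have "(\<exists>i<n. Q i) \<longleftrightarrow> 0 < (\<Sum>i<n. of_bool (Q i) :: nat)" for n :: nat and Q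
    by (auto simp: card_gt_0_iff)
  then show ?thesis by (simp only:) (intro pr_less pr_const pr_sum assms)
qed

lemma pr_all:
  assumes "pr (\<lambda>S z. of_bool (P S (p1 z) (p2 z)))" "pr N"
  shows "pr (\<lambda>S x. of_bool (\<forall>i<N S x. P S x i))"
  using pr_not[OF pr_ex[OF pr_not, OF assms]] by simp

lemma pr_div: "pr F \<Longrightarrow> pr G \<Longrightarrow> pr (\<lambda>S x. F S x div G S x)"
proof -
  \<comment> \<open>The quotient counts the positive multiples of \<open>b\<close> up to
    \<open>a\<close>. For \<open>b = 0\<close> that count would be \<open>a\<close>, whereas
    \<open>a div 0 = 0\<close>.\<close>
  have *: "a div b = (if b = 0 then 0 else \<Sum>i<a. of_bool (Suc i * b \<le> a))" for a b :: nat
  proof (cases "b = 0")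
    case False
    have "{i. i < a \<and> Suc i * b \<le> a} = {..<a div b}"
      using False by (auto simp: less_eq_div_iff_mult_less_eq Suc_le_eq[symmetric] simp del: mult_Suc)
        (metis False div_le_dividend le_trans less_eq_div_iff_mult_less_eq not_gr_zero)
    with False show ?thesis
      by (simp add: sum.If_cases of_bool_def Int_def lessThan_def del: mult_Suc)
  qed simp
  assume "pr F" "pr G"
  then show ?thesis
    by (subst *) (intro pr_if pr_eq pr_const pr_sum pr_le pr_mult pr_Suc pr_p2 pr_id
      pr_comp[OF \<open>pr F\<close>] pr_comp[OF \<open>pr G\<close>] pr_p1)
qed

lemma pr_mod: "pr F \<Longrightarrow> pr G \<Longrightarrow> pr (\<lambda>S x. F S x mod G S x)"
  unfolding minus_mult_div_eq_mod[symmetric] by (intro pr_diff pr_mult pr_div)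

lemmas pr_intros = pr_basic pr_add pr_diff pr_mult pr_power pr_sum pr_le pr_less pr_not pr_conj
  pr_disj pr_eq pr_if pr_ex pr_all pr_div pr_mod

text \<open>Summand \<open>i\<close> is 1 as long as nothing up to \<open>i\<close> satisfies
  \<open>P\<close>, so the sum is the least witness, or \<open>n\<close> if there is none below
  \<open>n\<close>.\<close>

definition bounded_least :: "(nat \<Rightarrow> bool) \<Rightarrow> nat \<Rightarrow> nat" where
  "bounded_least P n = (\<Sum>i<n. of_bool (\<forall>j<Suc i. \<not> P j))"

lemma bounded_least_eq:
  assumes "P m" "\<And>j. j < m \<Longrightarrow> \<not> P j"
  shows "bounded_least P n = min m n"
proof -
  have "(\<forall>j<Suc i. \<not> P j) \<longleftrightarrow> i < m" for i
    using assms by (meson less_Suc_eq_le linorder_not_less order.strict_trans1 less_le_trans)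
  then have "bounded_least P n = card {i \<in> {..<n}. i < m}"
    unfolding bounded_least_def by (simp add: sum.If_cases of_bool_def Int_def)
  also have "{i \<in> {..<n}. i < m} = {..<min m n}" by auto
  finally show ?thesis by simp
qed

lemma bounded_least:
  assumes "P m" "m < n"
  shows "P (bounded_least P n)" "bounded_least P n < n"
proof -
  have "P (LEAST m. P m)" "(LEAST m. P m) \<le> m" using assms(1) by (auto intro: LeastI Least_le)
  moreover have "bounded_least P n = min (LEAST m. P m) n"
    by (rule bounded_least_eq[of P, OF LeastI[of P, OF assms(1)]]) (rule not_less_Least)
  ultimately show "P (bounded_least P n)" "bounded_least P n < n" using assms(2) by auto
qed

lemma pr_bounded_least:
  assumes "pr (\<lambda>S z. of_bool (P S (p1 z) (p2 z)))" "pr N"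
  shows "pr (\<lambda>S x. bounded_least (P S x) (N S x))"
proof -
  have "pr (\<lambda>S z. of_bool (P S (p1 (p1 z)) (p2 z)))"
    by (intro pr_comp2[OF assms(1)] pr_intros)
  then show ?thesis unfolding bounded_least_def by (intro pr_intros assms(2))
qed

lemma pr_list_encode:
  assumes "pr (\<lambda>S z. f S (p1 z) (p2 z))" "pr N"
  shows "pr (\<lambda>S x. list_encode (map (f S x) [0..<N S x]))"
proof -
  \<comment> \<open>List codes are built from the tail, so the recursion visits the positions
    backwards.\<close>
  define step where "step S x n v = Suc (prod_encode (f S x (N S x - Suc n), v))" for S x n v
  have *: "n \<le> N S x \<Longrightarrow> rec_nat 0 (step S x) n = list_encode (map (f S x) [N S x - n..<N S x])" for S x n
  proof (induction n)
    case (Suc n)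
    then have "[N S x - Suc n..<N S x] = (N S x - Suc n) # [N S x - n..<N S x]"
      by (simp add: upt_conv_Cons Suc_diff_Suc)
    with Suc show ?case by (simp add: step_def)
  qed simp
  have "pr (\<lambda>S z. step S (p1 z) (p1 (p2 z)) (p2 (p2 z)))"
    unfolding step_def by (intro pr_comp2[OF assms(1)] pr_intros pr_comp[OF assms(2)])
  from pr_rec[of "\<lambda>_ _. 0", OF pr_const this assms(2)] show ?thesis by (simp add: *)
qed

section \<open>Programs with a hole\<close>

text \<open>The oracle query serves as the hole, so \<open>plug b D\<close> runs \<open>D\<close> with the set decided by \<open>b\<close> as oracle.\<close>

fun plug :: "code \<Rightarrow> code \<Rightarrow> code" where
  "plug b Query = b"
| "plug b (Tup f g) = Tup (plug b f) (plug b g)"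
| "plug b (Comp f g) = Comp (plug b f) (plug b g)"
| "plug b (Prec f g) = Prec (plug b f) (plug b g)"
| "plug b (Mu f) = Mu (plug b f)"
| "plug b c = c"

lemma runs_plug:
  assumes b: "\<And>y. runs S b y (of_bool (y \<in> B))"
  shows "runs B D x y \<Longrightarrow> runs S (plug b D) x y"
proof (induction rule: runs.induct)
  case (mu f x n)
  then show ?case by (auto intro!: runs.mu)
next
  case (query x)
  show ?case using b[of x] by simp
qed (auto intro: runs.intros)

text \<open>The construction carries only numbers, so the index of a plugged program has to be
  primitive recursive in the index of what is plugged in.\<close>

fun goedel_plug :: "code \<Rightarrow> nat \<Rightarrow> nat" where
  "goedel_plug Query n = n"
| "goedel_plug (Tup f g) n = prod_encode (5, prod_encode (goedel_plug f n, goedel_plug g n))"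
| "goedel_plug (Comp f g) n = prod_encode (6, prod_encode (goedel_plug f n, goedel_plug g n))"
| "goedel_plug (Prec f g) n = prod_encode (7, prod_encode (goedel_plug f n, goedel_plug g n))"
| "goedel_plug (Mu f) n = prod_encode (8, goedel_plug f n)"
| "goedel_plug c n = goedel c"

lemma goedel_plug: "goedel (plug b D) = goedel_plug D (goedel b)"
  by (induction D) auto

lemma pr_goedel_plug: "pr F \<Longrightarrow> pr (\<lambda>S x. goedel_plug D (F S x))"
  by (induction D) (simp_all del: goedel.simps, (intro pr_basic; assumption)+)

lemma pr_goedel_numeral_code:
  assumes "pr F" shows "pr (\<lambda>S x. goedel (numeral_code (F S x)))"
proof -
  have "goedel (numeral_code n) =
      rec_nat (goedel Zero) (\<lambda>_ v. prod_encode (6, prod_encode (goedel Succ, v))) n" for n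
    by (induction n) auto
  then show ?thesis by (simp only:) (intro pr_rec pr_basic assms)
qed

text \<open>The program discards its input, so running it on its own index is the search for a zero
  at the parameter \<open>d\<close>. One query to \<open>jump A\<close> thus settles an unbounded
  existential question about the decided set \<open>B\<close>.\<close>

lemma jump_search_iff:
  assumes b: "\<And>y. runs A b y (of_bool (y \<in> B))" and P: "\<And>S x. runs S P x (F S x)"
  shows "goedel (Comp (Mu (plug b P)) (numeral_code d)) \<in> jump A
    \<longleftrightarrow> (\<exists>n. F B (prod_encode (d, n)) = 0)"
proof -
  let ?c = "Comp (Mu (plug b P)) (numeral_code d)"
  have r: "runs A (plug b P) x (F B x)" for x
    by (rule runs_plug[of A b B, OF b P])
  have "goedel ?c \<in> jump A \<longleftrightarrow> (\<exists>y. runs A ?c (goedel ?c) y)"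
    unfolding jump_def using injD[OF inj_goedel] by blast
  also have "\<dots> \<longleftrightarrow> (\<exists>n. runs A (Mu (plug b P)) d n)"
  proof -
    have "runs A ?c x y \<longleftrightarrow> runs A (Mu (plug b P)) d y" for x y
    proof
      assume "runs A ?c x y"
      then obtain w where "runs A (numeral_code d) x w" "runs A (Mu (plug b P)) w y"
        by (rule runsE(7))
      then show "runs A (Mu (plug b P)) d y"
        using runs_deterministic[OF runs_numeral_code] by blast
    qed (rule runs.comp[OF runs_numeral_code])
    then show ?thesis by blast
  qed
  also have "\<dots> \<longleftrightarrow> (\<exists>n. F B (prod_encode (d, n)) = 0)"
  proof
    assume "\<exists>n. runs A (Mu (plug b P)) d n"
    then obtain n where "runs A (plug b P) (prod_encode (d, n)) 0" by (blast elim: runsE(10))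
    with r show "\<exists>n. F B (prod_encode (d, n)) = 0" using runs_deterministic by metis
  next
    assume *: "\<exists>n. F B (prod_encode (d, n)) = 0"
    define n where "n = (LEAST n. F B (prod_encode (d, n)) = 0)"
    have "F B (prod_encode (d, n)) = 0" unfolding n_def using * by (rule LeastI_ex)
    then have 0: "runs A (plug b P) (prod_encode (d, n)) 0" using r by metis
    have "\<exists>y. runs A (plug b P) (prod_encode (d, m)) (Suc y)" if "m < n" for m
      using not_less_Least[OF that[unfolded n_def]] r by (metis not0_implies_Suc)
    from runs.mu[OF 0 this] show "\<exists>n. runs A (Mu (plug b P)) d n" by blast
  qed
  finally show ?thesis .
qed

section \<open>Enumerating the programs without unbounded search\<close>

text \<open>
  A stack machine assembles programs in postfix notation. The stack \<open>0\<close> consists of infinitely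
  many copies of \<open>goedel Zero = 0\<close>, so no instruction ever fails; instruction \<open>0\<close> does nothing.
\<close>

definition stack_step :: "nat \<Rightarrow> nat \<Rightarrow> nat" where
  "stack_step i s =
    (if i = 0 then s
     else if i \<le> 5 then prod_encode (prod_encode (i - 1, 0), s)
     else if i \<le> 8 then prod_encode (prod_encode (i - 1, prod_encode (p1 (p2 s), p1 s)), p2 (p2 s))
     else s)"

definition machine_step :: "nat \<Rightarrow> nat" where
  "machine_step z = prod_encode (stack_step (p1 (p2 z)) (p1 z), p2 (p2 z))"

text \<open>\<open>n\<close> is both the coded list of instructions and the number of steps, since a
  list of nonzero instructions is no longer than its code. Past the end of the list the code is 0,
  which decodes to instruction 0 for ever.\<close>

definition enum_goedel :: "nat \<Rightarrow> nat" where
  "enum_goedel n = p1 (p1 ((machine_step ^^ n) (prod_encode (0, n))))"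

definition enum_code :: "nat \<Rightarrow> code" where
  "enum_code n = inv goedel (enum_goedel n)"

lemma pr_enum_goedel: "pr F \<Longrightarrow> pr (\<lambda>S x. enum_goedel (F S x))"
proof -
  assume F: "pr F"
  have "(f ^^ n) z = rec_nat z (\<lambda>_. f) n" for f :: "nat \<Rightarrow> nat" and n z by (induction n) auto
  then show ?thesis
    unfolding enum_goedel_def machine_step_def stack_step_def
    by (simp only:) (intro pr_rec pr_intros F)
qed

lemma p_zero [simp]: "p1 0 = 0" "p2 0 = 0"
  using p1_encode[of 0 0] p2_encode[of 0 0] by (simp_all add: prod_encode_def)

definition wf_stack :: "nat \<Rightarrow> bool" where
  "wf_stack s \<longleftrightarrow> (\<forall>n. p1 ((p2 ^^ n) s) \<in> goedel ` {c. mufree c})"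

lemma wf_stack_iff: "wf_stack s \<longleftrightarrow> p1 s \<in> goedel ` {c. mufree c} \<and> wf_stack (p2 s)"
proof -
  have "(\<forall>n. P ((p2 ^^ n) s)) \<longleftrightarrow> P s \<and> (\<forall>n. P ((p2 ^^ n) (p2 s)))" for P :: "nat \<Rightarrow> bool"
  proof -
    have "(\<forall>n. Q n) \<longleftrightarrow> Q 0 \<and> (\<forall>n. Q (Suc n))" for Q :: "nat \<Rightarrow> bool"
      by (metis not0_implies_Suc)
    from this[of "\<lambda>n. P ((p2 ^^ n) s)"] show ?thesis by (simp add: funpow_swap1)
  qed
  then show ?thesis unfolding wf_stack_def .
qed

lemma wf_stack_0: "wf_stack 0"
proof -
  have "(p2 ^^ n) 0 = 0" for n by (induction n) auto
  moreover have "0 = goedel Zero" by (simp add: prod_encode_def)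
  ultimately show ?thesis unfolding wf_stack_def by (metis image_eqI mem_Collect_eq mufree.simps(5) p_zero(1))
qed

lemma wf_stack_push: "wf_stack s \<Longrightarrow> mufree c \<Longrightarrow> wf_stack (prod_encode (goedel c, s))"
  by (subst wf_stack_iff) simp

lemma wf_stack_step:
  assumes "wf_stack s" shows "wf_stack (stack_step i s)"
proof -
  obtain f g where fg: "mufree f" "mufree g" "p1 s = goedel g" "p1 (p2 s) = goedel f"
    and s: "wf_stack (p2 (p2 s))"
    using assms wf_stack_iff[of s] wf_stack_iff[of "p2 s"] by auto
  consider "i = 0 \<or> i > 8" | "i = 1" | "i = 2" | "i = 3" | "i = 4" | "i = 5" | "i = 6" | "i = 7" | "i = 8"
    by linarith
  then show ?thesis
  proof cases
    case 1 then show ?thesis using assms by (auto simp: stack_step_def)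
  next
    case 2 then show ?thesis using wf_stack_push[OF assms, of Zero] by (simp add: stack_step_def)
  next
    case 3 then show ?thesis using wf_stack_push[OF assms, of Succ] by (simp add: stack_step_def)
  next
    case 4 then show ?thesis using wf_stack_push[OF assms, of Fst] by (simp add: stack_step_def)
  next
    case 5 then show ?thesis using wf_stack_push[OF assms, of Snd] by (simp add: stack_step_def)
  next
    case 6 then show ?thesis using wf_stack_push[OF assms, of Query] by (simp add: stack_step_def)
  next
    case 7 then show ?thesis using wf_stack_push[OF s, of "Tup f g"] fg by (simp add: stack_step_def)
  next
    case 8 then show ?thesis using wf_stack_push[OF s, of "Comp f g"] fg by (simp add: stack_step_def)
  next
    case 9 then show ?thesis using wf_stack_push[OF s, of "Prec f g"] fg by (simp add: stack_step_def)
  qed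
qed

lemma enum_goedel: "enum_goedel n \<in> goedel ` {c. mufree c}"
proof -
  have "wf_stack (p1 ((machine_step ^^ k) (prod_encode (0, n))))" for k
    by (induction k) (simp_all add: wf_stack_0 machine_step_def wf_stack_step)
  then show ?thesis unfolding enum_goedel_def using wf_stack_iff by blast
qed

lemma mufree_enum_code: "mufree (enum_code n)"
  and goedel_enum_code: "goedel (enum_code n) = enum_goedel n"
  using enum_goedel[of n] inj_goedel by (auto simp: enum_code_def)

lemma machine_run:
  assumes "length is \<le> n"
  shows "(machine_step ^^ n) (prod_encode (s, foldr (\<lambda>i r. prod_encode (i, r)) is 0)) =
    prod_encode (foldl (\<lambda>s i. stack_step i s) s is, 0)"
  using assms
proof (induction "is" arbitrary: s n)
  case Nil
  have "machine_step (prod_encode (s, 0)) = prod_encode (s, 0)"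
    by (simp add: machine_step_def stack_step_def)
  then show ?case by (induction n) simp_all
next
  case (Cons i "is")
  then obtain m where "n = Suc m" "length is \<le> m" by (cases n) auto
  moreover have "machine_step (prod_encode (s, foldr (\<lambda>i r. prod_encode (i, r)) (i # is) 0)) =
      prod_encode (stack_step i s, foldr (\<lambda>i r. prod_encode (i, r)) is 0)"
    by (simp add: machine_step_def)
  ultimately show ?case by (simp add: funpow_Suc_right Cons.IH del: funpow.simps foldr.simps)
qed

lemma length_le_program:
  "0 \<notin> set is \<Longrightarrow> length is \<le> foldr (\<lambda>i r. prod_encode (i, r)) is 0"
proof (induction "is")
  case (Cons i "is")
  have "m \<le> triangle m" for m by (induction m) simp_all
  from this[of "i + r" for r] have "i + r \<le> prod_encode (i, r)" for r
    by (simp add: prod_encode_def trans_le_add1)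
  from this[of "foldr (\<lambda>i r. prod_encode (i, r)) is 0"] Cons show ?case by simp
qed simp

lemma stack_step_simps:
  "stack_step 1 s = prod_encode (goedel Zero, s)"
  "stack_step 2 s = prod_encode (goedel Succ, s)"
  "stack_step 3 s = prod_encode (goedel Fst, s)"
  "stack_step 4 s = prod_encode (goedel Snd, s)"
  "stack_step 5 s = prod_encode (goedel Query, s)"
  "stack_step 6 (prod_encode (goedel g, prod_encode (goedel f, s))) = prod_encode (goedel (Tup f g), s)"
  "stack_step 7 (prod_encode (goedel g, prod_encode (goedel f, s))) = prod_encode (goedel (Comp f g), s)"
  "stack_step 8 (prod_encode (goedel g, prod_encode (goedel f, s))) = prod_encode (goedel (Prec f g), s)"
  by (simp_all add: stack_step_def)

text \<open>Quantifying over the stack below lets the programs of two arguments be concatenated.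
  Excluding instruction 0 feeds the length bound \<open>length_le_program\<close>.\<close>

lemma mufree_program:
  "mufree c \<Longrightarrow> \<exists>is. 0 \<notin> set is \<and> (\<forall>s. foldl (\<lambda>s i. stack_step i s) s is = prod_encode (goedel c, s))"
proof (induction c)
  case Zero show ?case by (rule exI[of _ "[1]"]) (simp add: stack_step_simps del: goedel.simps One_nat_def)
next
  case Succ show ?case by (rule exI[of _ "[2]"]) (simp add: stack_step_simps del: goedel.simps One_nat_def)
next
  case Fst show ?case by (rule exI[of _ "[3]"]) (simp add: stack_step_simps del: goedel.simps One_nat_def)
next
  case Snd show ?case by (rule exI[of _ "[4]"]) (simp add: stack_step_simps del: goedel.simps One_nat_def)
next
  case Query show ?case by (rule exI[of _ "[5]"]) (simp add: stack_step_simps del: goedel.simps One_nat_def)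
next
  case (Tup f g)
  then obtain k l where kl: "0 \<notin> set k" "0 \<notin> set l"
    "\<forall>s. foldl (\<lambda>s i. stack_step i s) s k = prod_encode (goedel f, s)"
    "\<forall>s. foldl (\<lambda>s i. stack_step i s) s l = prod_encode (goedel g, s)" by auto
  show ?case by (rule exI[of _ "k @ l @ [6]"]) (simp add: stack_step_simps kl del: goedel.simps One_nat_def)
next
  case (Comp f g)
  then obtain k l where kl: "0 \<notin> set k" "0 \<notin> set l"
    "\<forall>s. foldl (\<lambda>s i. stack_step i s) s k = prod_encode (goedel f, s)"
    "\<forall>s. foldl (\<lambda>s i. stack_step i s) s l = prod_encode (goedel g, s)" by auto
  show ?case by (rule exI[of _ "k @ l @ [7]"]) (simp add: stack_step_simps kl del: goedel.simps One_nat_def)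
next
  case (Prec f g)
  then obtain k l where kl: "0 \<notin> set k" "0 \<notin> set l"
    "\<forall>s. foldl (\<lambda>s i. stack_step i s) s k = prod_encode (goedel f, s)"
    "\<forall>s. foldl (\<lambda>s i. stack_step i s) s l = prod_encode (goedel g, s)" by auto
  show ?case by (rule exI[of _ "k @ l @ [8]"]) (simp add: stack_step_simps kl del: goedel.simps One_nat_def)
qed simp

lemma enum_code_surj:
  assumes "mufree c" shows "\<exists>n. enum_code n = c"
proof -
  obtain k where k: "0 \<notin> set k" "\<forall>s. foldl (\<lambda>s i. stack_step i s) s k = prod_encode (goedel c, s)"
    using mufree_program[OF assms] by blast
  define n where "n = foldr (\<lambda>i r. prod_encode (i, r)) k 0"
  have "enum_goedel n = goedel c"
    unfolding enum_goedel_def using machine_run[of k n 0] length_le_program[OF k(1)] k(2) n_def by simp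
  then show ?thesis by (metis enum_code_def inv_f_f inj_goedel)
qed

section \<open>Computation with bounded fuel\<close>

text \<open>
  The value is \<open>Suc y\<close> if the program outputs \<open>y\<close> without any search passing \<open>t\<close>, and \<open>0\<close> if it
  has not halted. This removes \<open>Mu\<close> from every program at the price of one extra argument.
\<close>

fun fuel :: "code \<Rightarrow> nat set \<Rightarrow> nat \<Rightarrow> nat \<Rightarrow> nat" where
  "fuel Zero S x t = 1"
| "fuel Succ S x t = Suc (Suc x)"
| "fuel Fst S x t = Suc (p1 x)"
| "fuel Snd S x t = Suc (p2 x)"
| "fuel Query S x t = Suc (of_bool (x \<in> S))"
| "fuel (Tup f g) S x t =
    (if fuel f S x t = 0 \<or> fuel g S x t = 0 then 0
     else Suc (prod_encode (fuel f S x t - 1, fuel g S x t - 1)))"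
| "fuel (Comp f g) S x t = (if fuel g S x t = 0 then 0 else fuel f S (fuel g S x t - 1) t)"
| "fuel (Prec f g) S x t = rec_nat (fuel f S (p1 x) t)
    (\<lambda>n v. if v = 0 then 0 else fuel g S (prod_encode (p1 x, prod_encode (n, v - 1))) t) (p2 x)"
| "fuel (Mu f) S x t =
    (if fuel f S (prod_encode (x, bounded_least (\<lambda>n. fuel f S (prod_encode (x, n)) t \<le> 1) t)) t = 1
     then Suc (bounded_least (\<lambda>n. fuel f S (prod_encode (x, n)) t \<le> 1) t) else 0)"

lemma pr_fuel: "pr F \<Longrightarrow> pr G \<Longrightarrow> pr (\<lambda>S x. fuel c S (F S x) (G S x))"
proof (induction c arbitrary: F G)
  case (Tup f g) then show ?case by (simp only: fuel.simps) (intro pr_intros Tup.IH; assumption)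
next
  case (Comp f g) then show ?case by (simp only: fuel.simps) (intro pr_intros Comp.IH; assumption)
next
  case (Prec f g)
  have "pr (\<lambda>S z. fuel (Prec f g) S (p1 z) (p2 z))"
    by (simp only: fuel.simps) (intro pr_intros pr_rec Prec.IH)
  then show ?case using pr_comp2 Prec.prems by blast
next
  case (Mu f)
  have "pr (\<lambda>S z. fuel (Mu f) S (p1 z) (p2 z))"
    by (simp only: fuel.simps) (intro pr_intros pr_bounded_least Mu.IH)
  then show ?case using pr_comp2 Mu.prems by blast
qed (simp_all only: fuel.simps, (intro pr_intros; assumption)+)

lemma fuel_Prec_Suc:
  "fuel (Prec f g) S (prod_encode (x, Suc n)) t =
    (let v = fuel (Prec f g) S (prod_encode (x, n)) t
     in if v = 0 then 0 else fuel g S (prod_encode (x, prod_encode (n, v - 1))) t)"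
  by (simp add: Let_def cong: if_cong)

lemma fuel_sound: "fuel c S x t = Suc y \<Longrightarrow> runs S c x y"
proof (induction c arbitrary: x y)
  case (Tup f g)
  then obtain u v where "fuel f S x t = Suc u" "fuel g S x t = Suc v" "y = prod_encode (u, v)"
    by (auto split: if_splits simp: gr0_conv_Suc)
  then show ?case using Tup.IH runs.tup by blast
next
  case (Comp f g)
  then obtain u where "fuel g S x t = Suc u" "fuel f S u t = Suc y"
    by (auto split: if_splits simp: gr0_conv_Suc)
  then show ?case using Comp.IH runs.comp by blast
next
  case (Prec f g)
  have "fuel (Prec f g) S (prod_encode (w, n)) t = Suc y \<Longrightarrow>
      runs S (Prec f g) (prod_encode (w, n)) y" for w n y
  proof (induction n arbitrary: y)
    case 0 then show ?case by (auto intro: runs.prec_0 Prec.IH)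
  next
    case (Suc n)
    then obtain v where "fuel (Prec f g) S (prod_encode (w, n)) t = Suc v"
      "fuel g S (prod_encode (w, prod_encode (n, v))) t = Suc y"
      unfolding fuel_Prec_Suc Let_def by (auto simp del: fuel.simps split: if_splits simp: gr0_conv_Suc)
    with Suc.IH show ?case by (blast intro: runs.prec_Suc Prec.IH)
  qed
  from this[of "p1 x" "p2 x" y] Prec.prems show ?case by simp
next
  case (Mu f)
  \<comment> \<open>The search stops at an output 0 or at an argument without a value so far; the
    latter is then rejected. If nothing stops it below \<open>t\<close>, the check is made at
    \<open>t\<close>, which is sound as all smaller arguments have positive values.\<close>
  define P where "P = (\<lambda>n. fuel f S (prod_encode (x, n)) t \<le> 1)"
  have y: "y = bounded_least P t" and f: "fuel f S (prod_encode (x, y)) t = Suc 0"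
    using Mu.prems by (auto simp: P_def split: if_splits)
  have S: "\<exists>v. runs S f (prod_encode (x, m)) (Suc v)" if "m < y" for m
  proof -
    have "\<not> P m"
    proof
      assume "P m"
      then have "bounded_least P t = min (LEAST m. P m) t"
        by (rule bounded_least_eq[of P, OF LeastI]) (rule not_less_Least)
      also have "\<dots> \<le> m" using Least_le[of P m] \<open>P m\<close> by simp
      finally show False using that y by simp
    qed
    then obtain v where "fuel f S (prod_encode (x, m)) t = Suc (Suc v)"
      unfolding P_def by (metis not_less_eq_eq One_nat_def less_eq_Suc_le not0_implies_Suc Suc_pred gr0I le0 le_SucI order_refl)
    then show ?thesis using Mu.IH by blast
  qed
  show ?case by (rule runs.mu[OF Mu.IH[OF f] S])
next
  case (Query x y)
  then show ?case using runs.query[of S x] by simp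
qed (auto intro: runs.intros runs_Fst runs_Snd)

text \<open>The value is reached for all large \<open>t\<close>, so the bounds for finitely many
  subcomputations combine into one.\<close>

lemma fuel_complete: "runs S c x y \<Longrightarrow> \<forall>\<^sub>F t in sequentially. fuel c S x t = Suc y"
proof (induction rule: runs.induct)
  case (tup f x y g z)
  from tup.IH show ?case by eventually_elim simp
next
  case (comp g x y f z)
  from comp.IH show ?case by eventually_elim simp
next
  case (prec_Suc f g x n y z)
  from prec_Suc.IH show ?case
    unfolding fuel_Prec_Suc Let_def by eventually_elim (simp only: nat.distinct if_False diff_Suc_1)
next
  case (mu f x n)
  have "\<forall>\<^sub>F t in sequentially. \<forall>m\<in>{..<n}. \<exists>y. fuel f S (prod_encode (x, m)) t = Suc (Suc y)"
    using mu.IH(2) by (intro eventually_ball_finite) (fastforce elim: eventually_mono)+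
  with mu.IH(1) eventually_ge_at_top[of n] show ?case
  proof eventually_elim
    case (elim t)
    have "bounded_least (\<lambda>n. fuel f S (prod_encode (x, n)) t \<le> 1) t = min n t"
    proof (rule bounded_least_eq)
      fix j assume "j < n"
      with elim(3) obtain y where "fuel f S (prod_encode (x, j)) t = Suc (Suc y)" by blast
      then show "\<not> fuel f S (prod_encode (x, j)) t \<le> 1" by simp
    qed (use elim(1) in simp)
    with elim show ?case by simp
  qed
qed auto

section \<open>Digits\<close>

definition digit :: "nat \<Rightarrow> nat \<Rightarrow> nat \<Rightarrow> nat" where
  "digit B w i = w div B ^ i mod B"

definition undigits :: "nat \<Rightarrow> nat \<Rightarrow> (nat \<Rightarrow> nat) \<Rightarrow> nat" where
  "undigits B N x = (\<Sum>i<N. x i * B ^ i)"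

lemma undigits_cong: "(\<And>i. i < N \<Longrightarrow> x i = y i) \<Longrightarrow> undigits B N x = undigits B N y"
  unfolding undigits_def by (intro sum.cong) auto

lemma undigits_less: "(\<And>i. i < N \<Longrightarrow> x i < B) \<Longrightarrow> undigits B N x < B ^ N"
proof (induction N)
  case (Suc N)
  then have "undigits B N x < B ^ N" "Suc (x N) \<le> B" by (auto simp: Suc_le_eq)
  then have "undigits B N x + x N * B ^ N < Suc (x N) * B ^ N" "Suc (x N) * B ^ N \<le> B * B ^ N"
    by (simp, intro mult_right_mono) auto
  then show ?case by (simp add: undigits_def)
qed (simp add: undigits_def)

lemma digit_undigits:
  assumes "\<And>i. i < N \<Longrightarrow> x i < B" "j < N"
  shows "digit B (undigits B N x) j = x j"
  using assms
proof (induction N)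
  case (Suc N)
  have u: "undigits B (Suc N) x = undigits B N x + x N * B ^ N" by (simp add: undigits_def)
  have lt: "undigits B N x < B ^ N" using Suc.prems by (intro undigits_less) auto
  have B: "B > 0" using Suc.prems by (metis gr_zeroI not_less0)
  show ?case
  proof (cases "j = N")
    case True
    with lt B Suc.prems show ?thesis by (simp add: u digit_def)
  next
    case False
    then obtain d where d: "N = j + Suc d" using Suc.prems(2) less_iff_Suc_add by auto
    then have "B ^ N = B ^ j * (B * B ^ d)" by (simp add: power_add)
    then have "undigits B (Suc N) x div B ^ j mod B =
        (undigits B N x + B ^ j * (B * (B ^ d * x N))) div B ^ j mod B"
      by (simp only: u mult_ac)
    also have "\<dots> = undigits B N x div B ^ j mod B" using B by simp
    finally show ?thesis using Suc False by (simp add: digit_def)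
  qed
qed simp

lemma undigits_digit: "w < B ^ N \<Longrightarrow> undigits B N (digit B w) = w"
proof -
  have "undigits B N (digit B w) = w mod B ^ N"
  proof (induction N)
    case (Suc N)
    have "w mod B ^ Suc N = w mod (B ^ N * B)" by (simp add: mult.commute)
    also have "\<dots> = B ^ N * (w div B ^ N mod B) + w mod B ^ N" by (rule mod_mult2_eq)
    finally show ?case using Suc by (simp add: undigits_def digit_def mult.commute)
  qed (simp add: undigits_def)
  then show "w < B ^ N \<Longrightarrow> ?thesis" by simp
qed

lemma digit_less: "B > 0 \<Longrightarrow> digit B w i < B"
  by (simp add: digit_def)

lemma pr_digit: "pr F \<Longrightarrow> pr G \<Longrightarrow> pr H \<Longrightarrow> pr (\<lambda>S x. digit (F S x) (G S x) (H S x))"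
  unfolding digit_def by (intro pr_intros)

lemma pr_undigits:
  assumes "pr F" "pr G" "pr (\<lambda>S z. f S (p1 z) (p2 z))"
  shows "pr (\<lambda>S x. undigits (F S x) (G S x) (f S x))"
  unfolding undigits_def by (intro pr_intros assms pr_comp[OF assms(1)])

text \<open>Turns a primitive recursive count over the numbers below \<open>B ^ N\<close> into the
  cardinality of a set of tuples.\<close>

lemma card_digits:
  assumes "\<And>x y. (\<And>i. i < N \<Longrightarrow> x i = y i) \<Longrightarrow> P x = P y" and B: "B > 0"
  shows "(\<Sum>u<B ^ N. of_bool (P (digit B u))) = card {x \<in> {..<N} \<rightarrow>\<^sub>E {..<B}. P x}"
proof -
  have "(\<Sum>u<B ^ N. of_bool (P (digit B u))) = card {u \<in> {..<B ^ N}. P (digit B u)}"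
    by (simp add: sum.If_cases of_bool_def Int_def)
  also have "\<dots> = card {x \<in> {..<N} \<rightarrow>\<^sub>E {..<B}. P x}"
  proof (rule bij_betw_same_card[OF bij_betw_byWitness[where f' = "undigits B N"
        and f = "\<lambda>u. restrict (digit B u) {..<N}"]])
    have r: "P (restrict x {..<N}) = P x" "undigits B N (restrict x {..<N}) = undigits B N x" for x
      using assms(1)[of "restrict x {..<N}" x] undigits_cong[of N "restrict x {..<N}" x B] by auto
    show "\<forall>u\<in>{u \<in> {..<B ^ N}. P (digit B u)}. undigits B N (restrict (digit B u) {..<N}) = u"
      by (simp add: r undigits_digit)
    have d: "digit B (undigits B N x) i = x i" if "x \<in> {..<N} \<rightarrow>\<^sub>E {..<B}" "i < N" for x i
      using that by (intro digit_undigits) auto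
    show "\<forall>x\<in>{x \<in> {..<N} \<rightarrow>\<^sub>E {..<B}. P x}. restrict (digit B (undigits B N x)) {..<N} = x"
      using d by (auto simp: fun_eq_iff PiE_iff extensional_def)
    show "(\<lambda>u. restrict (digit B u) {..<N}) ` {u \<in> {..<B ^ N}. P (digit B u)}
        \<subseteq> {x \<in> {..<N} \<rightarrow>\<^sub>E {..<B}. P x}"
      using B by (auto simp: r digit_less PiE_iff)
    have "P (digit B (undigits B N x)) = P x" if "x \<in> {..<N} \<rightarrow>\<^sub>E {..<B}" for x
      using assms(1) d[OF that] by blast
    then show "undigits B N ` {x \<in> {..<N} \<rightarrow>\<^sub>E {..<B}. P x} \<subseteq> {u \<in> {..<B ^ N}. P (digit B u)}"
      by (auto intro!: undigits_less)
  qed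
  finally show ?thesis .
qed

section \<open>Closed sets of tuples, counted at finite levels\<close>

text \<open>
  A tuple of \<open>N\<close> strings of length \<open>k\<close> is a function \<open>x\<close> with \<open>x i < 2 ^ k\<close> for \<open>i < N\<close>, the bit at
  position \<open>t\<close> having weight \<open>2 ^ t\<close>; so restriction to length \<open>l\<close> is reduction modulo \<open>2 ^ l\<close>.
  The set \<open>B\<close> enumerates an open set of \<open>N\<close>-tuples of sequences, \<open>hit B N k x\<close> says that
  the basic open set of \<open>x\<close> has entered it by level \<open>k\<close>.
\<close>

definition hit :: "nat set \<Rightarrow> nat \<Rightarrow> nat \<Rightarrow> (nat \<Rightarrow> nat) \<Rightarrow> bool" where
  "hit B N k x \<longleftrightarrow>
    (\<exists>k'<Suc k. prod_encode (N, prod_encode (k', undigits (2 ^ k') N (\<lambda>i. x i mod 2 ^ k'))) \<in> B)"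

definition extensions :: "nat \<Rightarrow> nat \<Rightarrow> nat \<Rightarrow> (nat \<Rightarrow> nat) \<Rightarrow> (nat \<Rightarrow> nat) set" where
  "extensions N l j v = (\<Pi>\<^sub>E i\<in>{..<N}. {a. a < 2 ^ (l + j) \<and> a mod 2 ^ l = v i})"

definition good :: "nat set \<Rightarrow> nat \<Rightarrow> nat \<Rightarrow> nat \<Rightarrow> (nat \<Rightarrow> nat) \<Rightarrow> (nat \<Rightarrow> nat) set" where
  "good B N l j v = {x \<in> extensions N l j v. \<not> hit B N (l + j) x}"

text \<open>The complement of the open set has conditional measure at least \<open>2 ^ -r\<close> above \<open>v\<close>.\<close>

definition positive_above :: "nat set \<Rightarrow> nat \<Rightarrow> nat \<Rightarrow> (nat \<Rightarrow> nat) \<Rightarrow> nat \<Rightarrow> bool" where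
  "positive_above B N l v r \<longleftrightarrow> (\<forall>j. (2 ^ j) ^ N \<le> 2 ^ r * card (good B N l j v))"

lemma hit_cong: "(\<And>i. i < N \<Longrightarrow> x i = y i) \<Longrightarrow> hit B N k x \<longleftrightarrow> hit B N k y"
  unfolding hit_def by (auto cong: undigits_cong)

lemma hit_Un: "hit (B \<union> E) N k x \<longleftrightarrow> hit B N k x \<or> hit E N k x"
  unfolding hit_def by blast

lemma hit_mono: "B \<subseteq> E \<Longrightarrow> hit B N k x \<Longrightarrow> hit E N k x"
  unfolding hit_def by blast

lemma mod_power_mod: "a \<le> b \<Longrightarrow> (x::nat) mod 2 ^ b mod 2 ^ a = x mod 2 ^ a"
  by (intro mod_mod_cancel le_imp_power_dvd)

lemma hit_mod:
  assumes "k \<le> m" shows "hit B N k (\<lambda>i. x i mod 2 ^ m) \<longleftrightarrow> hit B N k x"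
  unfolding hit_def using assms by (intro ex_cong1 conj_cong refl) (simp add: mod_power_mod)

lemma hit_level_mono: "k \<le> m \<Longrightarrow> hit B N k x \<Longrightarrow> hit B N m x"
  unfolding hit_def by (meson le_trans less_Suc_eq_le)

section \<open>Counting extensions and good tuples\<close>

lemma card_residues:
  assumes "(a::nat) < 2 ^ l" shows "card {b. b < 2 ^ (l + j) \<and> b mod 2 ^ l = a} = 2 ^ j"
proof -
  have "bij_betw (\<lambda>c. c * 2 ^ l + a) {..<2 ^ j} {b. b < 2 ^ (l + j) \<and> b mod 2 ^ l = a}"
  proof (rule bij_betw_byWitness[where f' = "\<lambda>b. b div 2 ^ l"])
    have "c * 2 ^ l + a < 2 ^ (l + j)" if "c < 2 ^ j" for c :: nat
    proof -
      have "c * 2 ^ l + a < Suc c * 2 ^ l" using assms by simp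
      also have "\<dots> \<le> 2 ^ j * 2 ^ l" using that by (intro mult_right_mono) auto
      finally show ?thesis by (simp add: power_add mult.commute)
    qed
    then show "(\<lambda>c. c * 2 ^ l + a) ` {..<2 ^ j} \<subseteq> {b. b < 2 ^ (l + j) \<and> b mod 2 ^ l = a}"
      using assms by auto
    show "(\<lambda>b. b div 2 ^ l) ` {b. b < 2 ^ (l + j) \<and> b mod 2 ^ l = a} \<subseteq> {..<2 ^ j}"
      by (auto simp: less_mult_imp_div_less power_add mult.commute)
  qed (use assms in \<open>auto simp: div_mult_mod_eq\<close>)
  from bij_betw_same_card[OF this] show ?thesis by simp
qed

lemma finite_extensions: "finite (extensions N l j v)"
  unfolding extensions_def by (intro finite_PiE) auto

lemma finite_good: "finite (good B N l j v)"
  unfolding good_def by (simp add: finite_extensions)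

lemma card_extensions: "(\<And>i. i < N \<Longrightarrow> v i < 2 ^ l) \<Longrightarrow> card (extensions N l j v) = (2 ^ j) ^ N"
  unfolding extensions_def by (simp add: card_PiE card_residues)

lemma extensions_less: "y \<in> extensions N l j v \<Longrightarrow> i < N \<Longrightarrow> y i < 2 ^ (l + j)"
  unfolding extensions_def by auto

lemma extensions_mod: "y \<in> extensions N l j v \<Longrightarrow> i < N \<Longrightarrow> y i mod 2 ^ l = v i"
  unfolding extensions_def by (drule PiE_mem[where x = i]) auto

text \<open>Hits persist when the level grows, so the restriction of an unhit tuple is
  unhit.\<close>

lemma good_subset_UN:
  "good B N l (d + j) v \<subseteq> (\<Union>y\<in>good B N l d v. good B N (l + d) j y)"
proof
  fix x assume x: "x \<in> good B N l (d + j) v"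
  let ?y = "restrict (\<lambda>i. x i mod 2 ^ (l + d)) {..<N}"
  have "hit B N (l + d) ?y = hit B N (l + d) (\<lambda>i. x i mod 2 ^ (l + d))" by (rule hit_cong) auto
  also have "\<dots> = hit B N (l + d) x" by (rule hit_mod) simp
  finally have "\<not> hit B N (l + d) ?y"
    using x hit_level_mono[of "l + d" "l + (d + j)" B N x] by (auto simp: good_def)
  with x have "?y \<in> good B N l d v" "x \<in> good B N (l + d) j ?y"
    by (auto simp: good_def extensions_def PiE_iff mod_power_mod add.assoc)
  then show "x \<in> (\<Union>y\<in>good B N l d v. good B N (l + d) j y)" by blast
qed

lemma card_good_le: "(\<And>i. i < N \<Longrightarrow> v i < 2 ^ l) \<Longrightarrow> card (good B N l j v) \<le> (2 ^ j) ^ N"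
  using card_mono[of "extensions N l j v" "good B N l j v"]
  by (auto simp: card_extensions finite_extensions good_def)

lemma card_good_add_le: "card (good B N l (d + j) v) \<le> (\<Sum>y\<in>good B N l d v. card (good B N (l + d) j y))"
  by (rule le_trans[OF card_mono[OF _ good_subset_UN] card_UN_le[OF finite_good]])
    (simp add: finite_good)

text \<open>The density of the good tuples never increases with the level, so a lower bound that
  fails once fails at all later levels.\<close>

lemma card_good_mult: "card (good B N l (d + j) v) \<le> card (good B N l d v) * (2 ^ j) ^ N"
proof -
  have "(\<Sum>y\<in>good B N l d v. card (good B N (l + d) j y)) \<le> (\<Sum>y\<in>good B N l d v. (2 ^ j) ^ N)"
    by (intro sum_mono card_good_le) (auto simp: good_def extensions_less)
  with card_good_add_le[of B N l d j v] show ?thesis by simp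
qed

lemma positive_mono: "positive_above B N l v r \<Longrightarrow> r \<le> s \<Longrightarrow> positive_above B N l v s"
  unfolding positive_above_def by (meson le_trans mult_le_mono1 one_le_numeral power_increasing)

lemma positive_empty: "(\<And>i. i < N \<Longrightarrow> v i < 2 ^ l) \<Longrightarrow> positive_above {} N l v r"
  by (simp add: positive_above_def good_def hit_def card_extensions)

text \<open>At \<open>j = 0\<close> the only extension of \<open>v\<close> is \<open>v\<close>, up
  to the entries from \<open>N\<close> on, so \<open>v\<close> itself has to be good.\<close>

lemma positive_not_hit:
  assumes "positive_above B N l v r" "\<And>i. i < N \<Longrightarrow> v i < 2 ^ l"
  shows "\<not> hit B N l v"
proof -
  have "good B N l 0 v \<noteq> {}"
    using assms(1) unfolding positive_above_def by (metis card.empty mult_0_right not_one_le_zero power_0 power_one)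
  then obtain x where "x \<in> extensions N l 0 v" "\<not> hit B N l x" by (auto simp: good_def)
  moreover from this have "x i = v i" if "i < N" for i
  proof -
    have "x i < 2 ^ (l + 0)" "x i mod 2 ^ l = v i"
      using extensions_less[OF \<open>x \<in> extensions N l 0 v\<close> that]
        extensions_mod[OF \<open>x \<in> extensions N l 0 v\<close> that] .
    then show ?thesis by (metis add_0_right mod_less)
  qed
  ultimately show ?thesis using hit_cong[of N x v B l] by simp
qed

text \<open>A cylinder given by \<open>N\<close> strings of length \<open>l\<close> has measure
  \<open>2 ^ -(l * N)\<close>. Hence \<open>E\<close> has conditional measure at most
  \<open>2 ^ -(r + 1)\<close> above \<open>v\<close>, half of what was guaranteed.\<close>

lemma positive_Un:
  assumes "positive_above B N l v r" "\<And>i. i < N \<Longrightarrow> v i < 2 ^ l"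
    and small: "\<And>k. 2 ^ (r + 1 + l * N) * card {x \<in> {..<N} \<rightarrow>\<^sub>E {..<2 ^ k}. hit E N k x} \<le> (2 ^ k) ^ N"
  shows "positive_above (B \<union> E) N l v (r + 1)"
  unfolding positive_above_def
proof
  fix j
  let ?H = "{x \<in> {..<N} \<rightarrow>\<^sub>E {..<2 ^ (l + j)}. hit E N (l + j) x}"
  have "finite ?H" by (simp add: finite_PiE)
  moreover have "good B N l j v \<subseteq> good (B \<union> E) N l j v \<union> ?H"
    by (auto simp: good_def hit_Un extensions_def PiE_iff)
  ultimately have 1: "card (good B N l j v) \<le> card (good (B \<union> E) N l j v) + card ?H"
    by (meson card_Un_le card_mono finite_Un finite_good le_trans)
  have "(2 ^ l) ^ N * (2 ^ (r + 1) * card ?H) \<le> (2 ^ l) ^ N * (2 ^ j) ^ N"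
  proof -
    have "(2 ^ (l + j)) ^ N = ((2::nat) ^ l) ^ N * (2 ^ j) ^ N" by (simp add: power_add power_mult_distrib)
    moreover have "(2::nat) ^ (r + 1 + l * N) = (2 ^ l) ^ N * 2 ^ (r + 1)"
      by (simp add: power_add power_mult)
    ultimately show ?thesis using small[of "l + j"] by (simp only: mult.assoc)
  qed
  then have 2: "2 ^ (r + 1) * card ?H \<le> (2 ^ j) ^ N" by simp
  have "2 * (2 ^ j) ^ N \<le> 2 ^ (r + 1) * card (good B N l j v)"
    using assms(1) unfolding positive_above_def by simp
  also have "\<dots> \<le> 2 ^ (r + 1) * (card (good (B \<union> E) N l j v) + card ?H)"
    using 1 by (intro mult_left_mono) auto
  finally show "(2 ^ j) ^ N \<le> 2 ^ (r + 1) * card (good (B \<union> E) N l j v)"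
    using 2 by (simp add: add_mult_distrib2)
qed

text \<open>
  Doubling coordinate \<open>i\<close>: the good set becomes the fibre square over the remaining coordinates, and
  by Cauchy-Schwarz the density is at worst squared.
\<close>

lemma positive_split:
  assumes pos: "positive_above B N l v r" and i: "i < N"
    and hit: "\<And>k x. hit B' (Suc N) k x \<longleftrightarrow> hit B N k x \<or> hit B N k (\<lambda>m. x (if m = i then N else m))"
  shows "positive_above B' (Suc N) l (\<lambda>m. v (if m = N then i else m)) (2 * r)"
  unfolding positive_above_def
proof
  fix j
  let ?v = "\<lambda>m. v (if m = N then i else m)"
  define H where "H = (\<Pi>\<^sub>E m\<in>{..<N} - {i}. {a. a < 2 ^ (l + j) \<and> a mod 2 ^ l = v m})"
  \<comment> \<open>\<open>F y\<close> is the fibre over a choice \<open>y\<close> of the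
    coordinates other than \<open>i\<close>. Pairs from one fibre are the good values of the two
    copies.\<close>
  define F where "F y = {a. y(i := a) \<in> good B N l j v}" for y
  have finH: "finite H" unfolding H_def by (intro finite_PiE) auto
  have F_sub: "F y \<subseteq> {..<2 ^ (l + j)}" for y
    using i by (auto simp: F_def good_def extensions_def PiE_iff)
  have finF: "finite (F y)" for y
    using F_sub finite_subset by blast
  have cG: "card (good B N l j v) \<le> (\<Sum>y\<in>H. card (F y))"
  proof -
    have "(\<lambda>x. (restrict x ({..<N} - {i}), x i)) ` good B N l j v \<subseteq> Sigma H F"
    proof (intro image_subsetI SigmaI)
      fix x assume x: "x \<in> good B N l j v"
      then show "restrict x ({..<N} - {i}) \<in> H" by (auto simp: H_def good_def extensions_def PiE_iff)
      have "(restrict x ({..<N} - {i}))(i := x i) = x"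
        using x i by (auto simp: fun_eq_iff good_def extensions_def PiE_iff extensional_def)
      with x show "x i \<in> F (restrict x ({..<N} - {i}))" by (simp add: F_def)
    qed
    moreover have "inj_on (\<lambda>x. (restrict x ({..<N} - {i}), x i)) (good B N l j v)"
    proof (rule inj_onI)
      fix x y assume xy: "x \<in> good B N l j v" "y \<in> good B N l j v"
        and eq: "(restrict x ({..<N} - {i}), x i) = (restrict y ({..<N} - {i}), y i)"
      have "x m = y m" for m
      proof (cases "m < N \<and> m \<noteq> i")
        case True then show ?thesis using eq by (metis DiffI lessThan_iff prod.inject restrict_apply' singletonD)
      next
        case False then show ?thesis using eq xy by (auto simp: good_def extensions_def PiE_iff extensional_def)
      qed
      then show "x = y" by blast
    qed
    ultimately have "card (good B N l j v) \<le> card (Sigma H F)"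
      using finH finF by (intro card_inj_on_le) auto
    then show ?thesis using finH finF by (simp add: card_SigmaI)
  qed
  have cG': "(\<Sum>y\<in>H. card (F y) ^ 2) \<le> card (good B' (Suc N) l j ?v)"
  proof -
    let ?g = "\<lambda>(y, a, b). (y(i := a))(N := b) :: nat \<Rightarrow> nat"
    have "?g ` (SIGMA y:H. F y \<times> F y) \<subseteq> good B' (Suc N) l j ?v"
    proof (clarify)
      fix y a b assume y: "y \<in> H" and a: "a \<in> F y" and b: "b \<in> F y"
      let ?x = "(y(i := a))(N := b)"
      have a': "y(i := a) \<in> extensions N l j v" "\<not> hit B N (l + j) (y(i := a))"
        and b': "y(i := b) \<in> extensions N l j v" "\<not> hit B N (l + j) (y(i := b))"
        using a b by (auto simp: F_def good_def)
      have "hit B N (l + j) ?x = hit B N (l + j) (y(i := a))"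
        "hit B N (l + j) (\<lambda>m. ?x (if m = i then N else m)) = hit B N (l + j) (y(i := b))"
        by (rule hit_cong; simp)+
      with a' b' have "\<not> hit B' (Suc N) (l + j) ?x" by (simp add: hit)
      moreover have "?x \<in> extensions (Suc N) l j ?v"
        using a'(1) b'(1) i by (auto simp: extensions_def PiE_iff extensional_def less_Suc_eq split: if_splits)
      ultimately show "?x \<in> good B' (Suc N) l j ?v" by (simp add: good_def)
    qed
    moreover have "inj_on ?g (SIGMA y:H. F y \<times> F y)"
    proof (rule inj_onI)
      fix p q
      assume "p \<in> (SIGMA y:H. F y \<times> F y)" "q \<in> (SIGMA y:H. F y \<times> F y)" and g: "?g p = ?g q"
      then obtain y a b y' a' b' where pq: "p = (y, a, b)" "q = (y', a', b')"
        and y: "y \<in> H" "y' \<in> H" by blast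
      from g have eq: "(y(i := a))(N := b) = (y'(i := a'))(N := b')" by (simp add: pq)
      have "y m = y' m" for m
      proof (cases "m = i \<or> m = N")
        case True then show ?thesis using y by (auto simp: H_def PiE_iff extensional_def)
      next
        case False then show ?thesis using fun_cong[OF eq, of m] by simp
      qed
      moreover have "a = a'" "b = b'" using fun_cong[OF eq, of i] fun_cong[OF eq, of N] i by auto
      ultimately show "p = q" by (auto simp: pq)
    qed
    ultimately have "card (SIGMA y:H. F y \<times> F y) \<le> card (good B' (Suc N) l j ?v)"
      using card_inj_on_le[OF _ _ finite_good] by blast
    then show ?thesis using finH finF by (simp add: card_SigmaI card_cartesian_product power2_eq_square)
  qed
  have cH: "card H \<le> (2 ^ j) ^ (N - 1)"
  proof (cases "H = {}")
    case False
    have "card H = (\<Prod>m\<in>{..<N} - {i}. card {a. a < 2 ^ (l + j) \<and> a mod 2 ^ l = v m})"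
      unfolding H_def by (simp add: card_PiE)
    also have "\<dots> \<le> (\<Prod>m\<in>{..<N} - {i}. 2 ^ j)"
    proof (intro prod_mono conjI)
      fix m assume "m \<in> {..<N} - {i}"
      with False obtain a where "a mod 2 ^ l = v m" by (fastforce simp: H_def PiE_eq_empty_iff)
      then have "v m < 2 ^ l" by (metis mod_less_divisor zero_less_numeral zero_less_power)
      then show "card {a. a < 2 ^ (l + j) \<and> a mod 2 ^ l = v m} \<le> 2 ^ j" by (simp add: card_residues)
    qed simp
    finally show ?thesis using i by simp
  qed simp
  have cs: "(\<Sum>y\<in>H. card (F y)) ^ 2 \<le> card H * (\<Sum>y\<in>H. card (F y) ^ 2)"
  proof -
    have "real ((\<Sum>y\<in>H. card (F y)) ^ 2) \<le> real (card H * (\<Sum>y\<in>H. card (F y) ^ 2))"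
      using sum_squared_le_sum_of_squares[of "\<lambda>y. real (card (F y))" H] by (simp add: mult.commute)
    then show ?thesis by linarith
  qed
  let ?M = "(2::nat) ^ j"
  have "?M ^ N \<le> 2 ^ r * card (good B N l j v)" using pos by (simp add: positive_above_def)
  also have "\<dots> \<le> 2 ^ r * (\<Sum>y\<in>H. card (F y))" using cG by simp
  finally have "(?M ^ N) ^ 2 \<le> (2 ^ r * (\<Sum>y\<in>H. card (F y))) ^ 2" by (rule power_mono) simp
  also have "\<dots> = 2 ^ (2 * r) * (\<Sum>y\<in>H. card (F y)) ^ 2"
    by (simp add: power_mult_distrib power_mult[symmetric] mult.commute)
  \<comment> \<open>Cauchy-Schwarz brings in the number of fibres; its bound
    \<open>?M ^ (N - 1)\<close> is cancelled at the end.\<close>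
  also have "\<dots> \<le> 2 ^ (2 * r) * (?M ^ (N - 1) * card (good B' (Suc N) l j ?v))"
    using cs mult_mono[OF cH cG'] by (intro mult_left_mono) (auto intro: le_trans)
  also have "(?M ^ N) ^ 2 = ?M ^ (N - 1) * ?M ^ Suc N"
    using i by (cases N) (simp_all add: power2_eq_square)
  finally have "?M ^ (N - 1) * ?M ^ Suc N \<le> ?M ^ (N - 1) * (2 ^ (2 * r) * card (good B' (Suc N) l j ?v))"
    by (simp only: mult_ac)
  then show "?M ^ Suc N \<le> 2 ^ (2 * r) * card (good B' (Suc N) l j ?v)" by simp
qed

text \<open>Extensions with equal entries \<open>a\<close> and \<open>b\<close> are a fraction at
  most \<open>2 ^ -d\<close> of all, so they carry at most half of the measure
  \<open>2 ^ -r\<close>. By averaging, some other extension keeps conditional measure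
  \<open>2 ^ -(r + 1)\<close>.\<close>

lemma positive_extend:
  assumes pos: "positive_above B N l v r" and v: "\<And>i. i < N \<Longrightarrow> v i < 2 ^ l"
    and ab: "a < N" "b < N" "a \<noteq> b" and d: "r + 1 \<le> d"
  shows "\<exists>y\<in>extensions N l d v. y a \<noteq> y b \<and> positive_above B N (l + d) y (r + 1)"
proof (rule ccontr)
  assume no: "\<not> ?thesis"
  define E where "E = {y \<in> extensions N l d v. y a \<noteq> y b}"
  define D where "D = {y \<in> extensions N l d v. y a = y b}"
  have fin: "finite E" "finite D" by (simp_all add: E_def D_def finite_extensions)
  have ED: "E \<union> D = extensions N l d v" "E \<inter> D = {}" by (auto simp: E_def D_def)
  have cED: "card E + card D = (2 ^ d) ^ N"
    using card_Un_disjoint[OF fin ED(2)] card_extensions[OF v, where j = d] ED(1) by simp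
  have cD: "2 ^ (r + 1) * card D \<le> (2 ^ d) ^ N"
  proof -
    let ?f = "\<lambda>y. restrict y ({..<N} - {b})"
    have "inj_on ?f D"
    proof (rule inj_onI)
      fix x y assume x: "x \<in> D" and y: "y \<in> D" and eq: "?f x = ?f y"
      have *: "x m = y m" if "m < N" "m \<noteq> b" for m using fun_cong[OF eq, of m] that by simp
      have "x m = y m" for m
        using *[of m] *[of a] x y ab by (cases "m < N"; cases "m = b") (auto simp: D_def extensions_def PiE_iff extensional_def)
      then show "x = y" by blast
    qed
    moreover have "?f ` D \<subseteq> (\<Pi>\<^sub>E m\<in>{..<N} - {b}. {a. a < 2 ^ (l + d) \<and> a mod 2 ^ l = v m})" (is "_ \<subseteq> ?P")
      by (intro image_subsetI, subst restrict_PiE_iff) (auto simp: D_def extensions_less extensions_mod)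
    moreover have "finite ?P" by (intro finite_PiE) auto
    ultimately have "card D \<le> card ?P" by (rule card_inj_on_le)
    also have "\<dots> = (2 ^ d) ^ (N - 1)" using v ab by (simp add: card_PiE card_residues)
    finally have "2 ^ (r + 1) * card D \<le> 2 ^ d * (2 ^ d) ^ (N - 1)"
      using d by (intro mult_mono power_increasing) auto
    then show ?thesis using ab by (metis power_eq_if less_nat_zero_code)
  qed
  have "\<forall>y\<in>E. \<exists>j. 2 ^ (r + 1) * card (good B N (l + d) j y) < (2 ^ j) ^ N"
    using no unfolding positive_above_def E_def by (auto simp: not_le)
  then obtain J where J: "\<And>y. y \<in> E \<Longrightarrow> 2 ^ (r + 1) * card (good B N (l + d) (J y) y) < (2 ^ J y) ^ N"
    by metis
  \<comment> \<open>Each extension fails at a level of its own; by \<open>card_good_mult\<close>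
    failures persist, so all are compared at one level.\<close>
  define K where "K = Max (insert 0 (J ` E))"
  have K: "2 ^ (r + 1) * card (good B N (l + d) K y) < (2 ^ K) ^ N" if "y \<in> E" for y
  proof -
    have "J y \<le> K" unfolding K_def using fin that by (intro Max_ge) auto
    then obtain c where c: "K = J y + c" using le_Suc_ex by blast
    have "2 ^ (r + 1) * card (good B N (l + d) K y) \<le>
        2 ^ (r + 1) * (card (good B N (l + d) (J y) y) * (2 ^ c) ^ N)"
      unfolding c by (intro mult_left_mono card_good_mult) simp
    also have "\<dots> < (2 ^ J y) ^ N * (2 ^ c) ^ N"
      using J[OF that] by (simp add: mult.assoc[symmetric] del: power_Suc)
    finally show ?thesis by (simp add: c power_add power_mult_distrib)
  qed
  \<comment> \<open>Without this the comparison of the sums over \<open>E\<close> would not be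
    strict.\<close>
  have "E \<noteq> {}"
  proof
    assume "E = {}"
    with cED cD have "2 ^ (r + 1) * (2 ^ d) ^ N \<le> ((2 ^ d) ^ N :: nat)" by simp
    then have "2 * 2 ^ r \<le> Suc 0" by simp
    moreover have "1 \<le> (2::nat) ^ r" by simp
    ultimately show False by linarith
  qed
  have "2 * ((2 ^ d) ^ N * (2 ^ K) ^ N) \<le> 2 ^ (r + 1) * card (good B N l (d + K) v)"
  proof -
    have "(2 ^ (d + K)) ^ N \<le> 2 ^ r * card (good B N l (d + K) v)"
      using pos unfolding positive_above_def by blast
    then show ?thesis by (simp add: power_add power_mult_distrib)
  qed
  also have "card (good B N l (d + K) v) \<le> (\<Sum>y\<in>extensions N l d v. card (good B N (l + d) K y))"
    by (rule le_trans[OF card_good_add_le sum_mono2]) (auto simp: finite_extensions good_def)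
  also have "\<dots> = (\<Sum>y\<in>E. card (good B N (l + d) K y)) + (\<Sum>y\<in>D. card (good B N (l + d) K y))"
    unfolding ED(1)[symmetric] by (rule sum.union_disjoint[OF fin ED(2)])
  also have "2 ^ (r + 1) * \<dots> = (\<Sum>y\<in>E. 2 ^ (r + 1) * card (good B N (l + d) K y)) +
      2 ^ (r + 1) * (\<Sum>y\<in>D. card (good B N (l + d) K y))"
    by (simp add: add_mult_distrib2 sum_distrib_left)
  also have "(\<Sum>y\<in>E. 2 ^ (r + 1) * card (good B N (l + d) K y)) < (\<Sum>y\<in>E. (2 ^ K) ^ N)"
    using K \<open>E \<noteq> {}\<close> fin by (intro sum_strict_mono) auto
  also have "2 ^ (r + 1) * (\<Sum>y\<in>D. card (good B N (l + d) K y)) \<le> 2 ^ (r + 1) * (\<Sum>y\<in>D. (2 ^ K) ^ N)"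
    by (intro mult_left_mono sum_mono card_good_le) (auto simp: D_def extensions_less)
  also have "\<dots> \<le> (2 ^ d) ^ N * (2 ^ K) ^ N" using cD by (simp add: mult.assoc[symmetric] del: power_Suc)
  also have "(\<Sum>y\<in>E. (2 ^ K) ^ N) \<le> (2 ^ d) ^ N * ((2::nat) ^ K) ^ N" using cED by simp
  finally show False by simp
qed

section \<open>The construction\<close>

definition code_of :: "(nat set \<Rightarrow> nat \<Rightarrow> nat) \<Rightarrow> code" where
  "code_of F = (SOME c. mufree c \<and> (\<forall>S x. runs S c x (F S x)))"

lemma runs_code_of:
  assumes "pr F" shows "runs S (code_of F) x (F S x)"
  using someI_ex[OF assms[unfolded pr_def]] unfolding code_of_def by blast

definition decides :: "nat set \<Rightarrow> nat \<Rightarrow> nat set \<Rightarrow> bool" where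
  "decides A g B \<longleftrightarrow> (\<exists>b. goedel b = g \<and> (\<forall>y. runs A b y (of_bool (y \<in> B))))"

lemma decides_unique: "decides A g B \<Longrightarrow> decides A g B' \<Longrightarrow> B = B'"
  unfolding decides_def using injD[OF inj_goedel] runs_deterministic
  by (metis of_bool_eq_iff subsetI subset_antisym)

text \<open>\<open>d\<close> packs \<open>(N, l, w, r)\<close>, the strings being the digits of
  \<open>w\<close>. A value 0 at some \<open>j\<close> refutes the lower bound, so failure can be
  found by search.\<close>

definition positive_fun :: "nat set \<Rightarrow> nat \<Rightarrow> nat \<Rightarrow> nat" where
  "positive_fun S d j =
    (let N = p1 d; l = p1 (p2 d); w = p1 (p2 (p2 d)); r = p2 (p2 (p2 d)) in
     of_bool (((2::nat) ^ j) ^ N \<le> 2 ^ r * (\<Sum>u<(2 ^ (l + j)) ^ N. of_bool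
       ((\<forall>i<N. digit (2 ^ (l + j)) u i mod 2 ^ l = digit (2 ^ l) w i) \<and>
        \<not> hit S N (l + j) (digit (2 ^ (l + j)) u)))))"

lemma pr_hit:
  assumes "pr F" "pr G" "pr (\<lambda>S z. X S (p1 z) (p2 z))"
  shows "pr (\<lambda>S x. of_bool (hit S (F S x) (G S x) (X S x)))"
  unfolding hit_def
  by (intro pr_intros pr_undigits assms pr_comp[OF assms(1)] pr_comp[OF assms(2)] pr_comp2[OF assms(3)])

lemma pr_positive_fun: "pr (\<lambda>S z. positive_fun S (p1 z) (p2 z))"
  unfolding positive_fun_def Let_def by (intro pr_intros pr_digit pr_hit)

lemma positive_fun:
  "positive_above B N l (digit (2 ^ l) w) r \<longleftrightarrow>
    (\<forall>j. positive_fun B (prod_encode (N, prod_encode (l, prod_encode (w, r)))) j \<noteq> 0)"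
proof -
  have *: "(\<Sum>u<(2 ^ (l + j)) ^ N. of_bool
       ((\<forall>i<N. digit (2 ^ (l + j)) u i mod 2 ^ l = digit (2 ^ l) w i) \<and>
        \<not> hit B N (l + j) (digit (2 ^ (l + j)) u))) = card (good B N l j (digit (2 ^ l) w))" for j
  proof (subst card_digits)
    show "((\<forall>i<N. x i mod 2 ^ l = digit (2 ^ l) w i) \<and> \<not> hit B N (l + j) x) =
      ((\<forall>i<N. y i mod 2 ^ l = digit (2 ^ l) w i) \<and> \<not> hit B N (l + j) y)"
      if "\<And>i. i < N \<Longrightarrow> x i = y i" for x y
      using hit_cong[of N x y] that by auto
    show "card {x \<in> {..<N} \<rightarrow>\<^sub>E {..<2 ^ (l + j)}. (\<forall>i<N. x i mod 2 ^ l = digit (2 ^ l) w i) \<and> \<not> hit B N (l + j) x} =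
      card (good B N l j (digit (2 ^ l) w))"
      by (rule arg_cong[where f = card]) (auto simp: good_def extensions_def PiE_iff)
  qed simp
  show ?thesis unfolding positive_above_def positive_fun_def Let_def p1_encode p2_encode * by simp
qed

text \<open>The index from \<open>jump_search_iff\<close>, spelled out with the tags 6 of
  \<open>Comp\<close> and 8 of \<open>Mu\<close> to be primitive recursive in all arguments. The
  program searches for a level that refutes positivity.\<close>

definition goedel_positive :: "nat \<Rightarrow> nat \<Rightarrow> nat \<Rightarrow> nat \<Rightarrow> nat \<Rightarrow> nat" where
  "goedel_positive g N l w r =
    prod_encode (6, prod_encode (prod_encode (8, goedel_plug (code_of (\<lambda>S z. positive_fun S (p1 z) (p2 z))) g),
      goedel (numeral_code (prod_encode (N, prod_encode (l, prod_encode (w, r)))))))"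

lemma goedel_positive_in_jump:
  assumes "decides A g B"
  shows "goedel_positive g N l w r \<in> jump A \<longleftrightarrow> \<not> positive_above B N l (digit (2 ^ l) w) r"
proof -
  obtain b where b: "goedel b = g" "\<And>y. runs A b y (of_bool (y \<in> B))"
    using assms unfolding decides_def by blast
  show ?thesis
    using jump_search_iff[of A b B, OF b(2) runs_code_of[OF pr_positive_fun]]
    by (simp add: goedel_positive_def positive_fun b(1)[symmetric] goedel_plug[symmetric])
qed

text \<open>Index of the disjunction of program \<open>g\<close> with program \<open>h\<close> at
  first argument \<open>m\<close>; the tags 5 and 6 are those of \<open>Tup\<close> and
  \<open>Comp\<close>.\<close>

definition goedel_union :: "nat \<Rightarrow> nat \<Rightarrow> nat \<Rightarrow> nat" where
  "goedel_union g h m =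
    prod_encode (6, prod_encode (goedel (code_of (\<lambda>S z. of_bool (p1 z \<noteq> 0 \<or> p2 z \<noteq> 0))),
      prod_encode (5, prod_encode (g,
        prod_encode (6, prod_encode (h,
          prod_encode (5, prod_encode (goedel (numeral_code m), goedel (code_of (\<lambda>S x. x))))))))))"

text \<open>The \<open>m\<close>-th open set of a prospective test, given by codes of basic open
  sets as in \<open>hit\<close>. It is decidable in \<open>A\<close> when \<open>e\<close> is
  \<open>mufree\<close>, since \<open>e\<close> is then total.\<close>

definition component :: "nat set \<Rightarrow> code \<Rightarrow> nat \<Rightarrow> nat set" where
  "component A e m = {y. \<exists>v. runs A e (prod_encode (m, y)) (Suc v)}"

lemma decides_union:
  assumes "decides A g B" "mufree e"
  shows "decides A (goedel_union g (goedel e) m) (B \<union> component A e m)"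
proof -
  obtain b where b: "goedel b = g" "\<And>y. runs A b y (of_bool (y \<in> B))"
    using assms(1) unfolding decides_def by blast
  obtain F where F: "\<And>x. runs A e x (F x)" using mufree_total[OF assms(2)] by blast
  have or: "pr (\<lambda>S z. of_bool (p1 z \<noteq> 0 \<or> p2 z \<noteq> 0))" by (intro pr_intros)
  let ?c = "Comp (code_of (\<lambda>S z. of_bool (p1 z \<noteq> 0 \<or> p2 z \<noteq> 0)))
    (Tup b (Comp e (Tup (numeral_code m) (code_of (\<lambda>S x. x)))))"
  have "runs A ?c y (of_bool (y \<in> B \<union> component A e m))" for y
  proof -
    have "runs A (Comp e (Tup (numeral_code m) (code_of (\<lambda>S x. x)))) y (F (prod_encode (m, y)))"
      by (rule runs.comp[OF runs.tup[OF runs_numeral_code runs_code_of[OF pr_id]] F])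
    from runs.comp[OF runs.tup[OF b(2) this] runs_code_of[OF or]]
    have "runs A ?c y (of_bool (y \<in> B \<or> F (prod_encode (m, y)) \<noteq> 0))" by simp
    moreover have "y \<in> component A e m \<longleftrightarrow> F (prod_encode (m, y)) \<noteq> 0"
    proof -
      have "runs A e x v \<longleftrightarrow> v = F x" for x v using F runs_deterministic by blast
      then show ?thesis by (cases "F (prod_encode (m, y))") (simp_all add: component_def)
    qed
    ultimately show ?thesis by simp
  qed
  moreover have "goedel ?c = goedel_union g (goedel e) m" by (simp add: goedel_union_def b(1))
  ultimately show ?thesis unfolding decides_def by blast
qed

text \<open>An \<open>N + 1\<close>-tuple avoids this set iff its first \<open>N\<close> entries
  avoid \<open>S\<close>, both as they are and with entry \<open>N div 2\<close> replaced by the new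
  entry \<open>N\<close>. Elements code \<open>N + 1\<close>-tuples, hence
  \<open>p1 y - 1\<close>.\<close>

definition split_set :: "nat set \<Rightarrow> nat set" where
  "split_set S = {y. let N = p1 y - 1; k = p1 (p2 y); w = p2 (p2 y) in
    prod_encode (N, prod_encode (k, undigits (2 ^ k) N (digit (2 ^ k) w))) \<in> S \<or>
    prod_encode (N, prod_encode (k, undigits (2 ^ k) N
      (\<lambda>i. digit (2 ^ k) w (if i = N div 2 then N else i)))) \<in> S}"

lemma pr_split_set: "pr (\<lambda>S y. of_bool (y \<in> split_set S))"
  unfolding split_set_def Let_def mem_Collect_eq by (intro pr_intros pr_undigits pr_digit)

lemma split_set_iff:
  "prod_encode (Suc N, prod_encode (k, w)) \<in> split_set S \<longleftrightarrow>
    prod_encode (N, prod_encode (k, undigits (2 ^ k) N (digit (2 ^ k) w))) \<in> S \<or>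
    prod_encode (N, prod_encode (k, undigits (2 ^ k) N
      (\<lambda>i. digit (2 ^ k) w (if i = N div 2 then N else i)))) \<in> S"
  by (simp add: split_set_def cong: if_cong)

lemma hit_split_set:
  "hit (split_set B) (Suc N) k x \<longleftrightarrow> hit B N k x \<or> hit B N k (\<lambda>m. x (if m = N div 2 then N else m))"
proof -
  have d: "digit (2 ^ k') (undigits (2 ^ k') (Suc N) (\<lambda>i. x i mod 2 ^ k')) i = x i mod 2 ^ k'"
    if "i < Suc N" for k' i
    using that by (intro digit_undigits) auto
  have "undigits (2 ^ k') N (digit (2 ^ k') (undigits (2 ^ k') (Suc N) (\<lambda>i. x i mod 2 ^ k'))) =
      undigits (2 ^ k') N (\<lambda>i. x i mod 2 ^ k')"
    "undigits (2 ^ k') N (\<lambda>i. digit (2 ^ k') (undigits (2 ^ k') (Suc N) (\<lambda>i. x i mod 2 ^ k'))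
        (if i = N div 2 then N else i)) =
      undigits (2 ^ k') N (\<lambda>i. x (if i = N div 2 then N else i) mod 2 ^ k')" for k'
    by (intro undigits_cong; simp add: d)+
  then show ?thesis unfolding hit_def split_set_iff by auto
qed

definition goedel_split :: "nat \<Rightarrow> nat" where
  "goedel_split = goedel_plug (code_of (\<lambda>S y. of_bool (y \<in> split_set S)))"

lemma decides_split: "decides A g B \<Longrightarrow> decides A (goedel_split g) (split_set B)"
  unfolding decides_def goedel_split_def
  using runs_plug[OF _ runs_code_of[OF pr_split_set]] goedel_plug by metis

text \<open>The length of the strings at stage \<open>N\<close>; it also measures the loss of density.\<close>

definition level :: "nat \<Rightarrow> nat" where "level N = 4 ^ N"

text \<open>\<open>p1 N\<close> takes every value infinitely often, so each program is tried
  infinitely often. The component number is the exponent in \<open>positive_Un\<close> with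
  \<open>l = r = level N\<close>. Membership in \<open>S\<close> means that the union leaves too
  little measure.\<close>

definition mid_code :: "nat set \<Rightarrow> nat \<Rightarrow> nat \<Rightarrow> nat \<Rightarrow> nat" where
  "mid_code S N g w =
    (if goedel_positive (goedel_union g (enum_goedel (p1 N)) (level N + 1 + level N * N)) N (level N) w (level N + 1) \<in> S
     then g else goedel_union g (enum_goedel (p1 N)) (level N + 1 + level N * N))"

text \<open>\<open>positive_extend\<close> provides a witness. As the length is fixed there are
  finitely many candidates, and each costs at most one query.\<close>

definition next_word :: "nat set \<Rightarrow> nat \<Rightarrow> nat \<Rightarrow> nat \<Rightarrow> nat" where
  "next_word S N g w = bounded_least (\<lambda>u.
     (\<forall>i<Suc N. digit (2 ^ level (Suc N)) u i mod 2 ^ level N = digit (2 ^ level N) w (if i = N then N div 2 else i)) \<and>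
     digit (2 ^ level (Suc N)) u (N div 2) \<noteq> digit (2 ^ level (Suc N)) u N \<and>
     goedel_positive g (Suc N) (level (Suc N)) u (level (Suc N)) \<notin> S) ((2 ^ level (Suc N)) ^ Suc N)"

text \<open>
  Stage \<open>N > 0\<close> holds a program for an open set to be avoided and the \<open>N\<close> strings so far, as the
  digits of one number. In passing to stage \<open>N + 1\<close> one more open set is put in if this leaves
  enough measure, and string \<open>N div 2\<close> is doubled.
\<close>

definition state :: "nat set \<Rightarrow> nat \<Rightarrow> nat" where
  "state S = rec_nat 0 (\<lambda>N z. if N = 0 then 0 else
     prod_encode (goedel_split (mid_code S N (p1 z) (p2 z)),
       next_word S N (goedel_split (mid_code S N (p1 z) (p2 z))) (p2 z)))"

definition leaf :: "nat set \<Rightarrow> nat \<Rightarrow> nat \<Rightarrow> nat" where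
  "leaf A N = digit (2 ^ level N) (p2 (state (jump A) N))"

text \<open>The state stores only an index; \<open>decides_unique\<close> makes the description
  definite.\<close>

definition avoided :: "nat set \<Rightarrow> nat \<Rightarrow> nat set" where
  "avoided A N = (THE B. decides A (p1 (state (jump A) N)) B)"

text \<open>The set after the test of stage \<open>N\<close> and before the doubling.\<close>

definition avoided_next :: "nat set \<Rightarrow> nat \<Rightarrow> nat set" where
  "avoided_next A N = (THE B. decides A (mid_code (jump A) N (p1 (state (jump A) N)) (p2 (state (jump A) N))) B)"

section \<open>Invariants of the construction\<close>

lemma the_decides: "decides A g B \<Longrightarrow> (THE B. decides A g B) = B"
  by (rule the_equality[OF _ decides_unique])

lemma leaf_less: "leaf A N i < 2 ^ level N"
  by (simp add: leaf_def digit_less)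

lemma level_ge: "0 < N \<Longrightarrow> 4 \<le> level N"
  unfolding level_def using power_increasing[of 1 N "4::nat"] by simp

lemma positive_cong: "(\<And>i. i < N \<Longrightarrow> v i = u i) \<Longrightarrow> positive_above B N l v r \<longleftrightarrow> positive_above B N l u r"
proof -
  assume "\<And>i. i < N \<Longrightarrow> v i = u i"
  then have "extensions N l j v = extensions N l j u" for j
    unfolding extensions_def by (intro PiE_cong) auto
  then show ?thesis by (simp add: positive_above_def good_def)
qed

lemma construction_step:
  assumes N: "0 < N" and dec: "decides A (p1 (state (jump A) N)) B"
    and pos: "positive_above B N (level N) (leaf A N) (level N)"
  defines "E \<equiv> component A (enum_code (p1 N)) (level N + 1 + level N * N)"
  defines "C \<equiv> if positive_above (B \<union> E) N (level N) (leaf A N) (level N + 1) then B \<union> E else B"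
  shows "decides A (mid_code (jump A) N (p1 (state (jump A) N)) (p2 (state (jump A) N))) C"
    and "decides A (p1 (state (jump A) (Suc N))) (split_set C)"
    and "positive_above (split_set C) (Suc N) (level (Suc N)) (leaf A (Suc N)) (level (Suc N))"
    and "i < Suc N \<Longrightarrow> leaf A (Suc N) i mod 2 ^ level N = leaf A N (if i = N then N div 2 else i)"
    and "leaf A (Suc N) (N div 2) \<noteq> leaf A (Suc N) N"
proof -
  define g where "g = p1 (state (jump A) N)"
  define w where "w = p2 (state (jump A) N)"
  define h where "h = mid_code (jump A) N g w"
  have leaf: "leaf A N = digit (2 ^ level N) w" by (simp add: leaf_def w_def)
  have decE: "decides A (goedel_union g (enum_goedel (p1 N)) (level N + 1 + level N * N)) (B \<union> E)"
    using decides_union[OF dec mufree_enum_code] by (simp add: g_def E_def goedel_enum_code)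
  show 1: "decides A (mid_code (jump A) N (p1 (state (jump A) N)) (p2 (state (jump A) N))) C"
    using dec decE goedel_positive_in_jump[OF decE]
    by (simp add: mid_code_def C_def leaf g_def[symmetric] w_def[symmetric])
  then have decC: "decides A (goedel_split h) (split_set C)"
    unfolding h_def g_def w_def by (rule decides_split)
  have st: "state (jump A) (Suc N) = prod_encode (goedel_split h, next_word (jump A) N (goedel_split h) w)"
    using N by (simp add: state_def h_def g_def w_def)
  show "decides A (p1 (state (jump A) (Suc N))) (split_set C)" using decC by (simp add: st)
  have "positive_above C N (level N) (leaf A N) (level N + 1)"
    using positive_mono[OF pos] by (simp add: C_def)
  then have "positive_above (split_set C) (Suc N) (level N) (\<lambda>m. leaf A N (if m = N then N div 2 else m)) (2 * (level N + 1))"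
    by (rule positive_split[OF _ _ hit_split_set]) (use N in simp)
  \<comment> \<open>Room for \<open>positive_extend\<close>:
    \<open>2 * (level N + 1) + 1 \<le> 3 * level N\<close>, because
    \<open>level N \<ge> 4\<close>.\<close>
  then have "\<exists>y\<in>extensions (Suc N) (level N) (3 * level N) (\<lambda>m. leaf A N (if m = N then N div 2 else m)).
      y (N div 2) \<noteq> y N \<and> positive_above (split_set C) (Suc N) (level N + 3 * level N) y (2 * (level N + 1) + 1)"
    using N level_ge[OF N] by (intro positive_extend) (auto simp: leaf_less)
  moreover have lev: "level N + 3 * level N = level (Suc N)" by (simp add: level_def)
  ultimately obtain y where y: "y \<in> extensions (Suc N) (level N) (3 * level N) (\<lambda>m. leaf A N (if m = N then N div 2 else m))"
    "y (N div 2) \<noteq> y N" "positive_above (split_set C) (Suc N) (level (Suc N)) y (2 * (level N + 1) + 1)" by auto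
  have ypos: "positive_above (split_set C) (Suc N) (level (Suc N)) y (level (Suc N))"
    using level_ge[OF N] by (intro positive_mono[OF y(3)]) (simp add: lev[symmetric])
  have y_less: "y i < 2 ^ level (Suc N)" if "i < Suc N" for i
    using extensions_less[OF y(1) that] by (simp add: lev)
  define P where "P u \<longleftrightarrow> (\<forall>i<Suc N. digit (2 ^ level (Suc N)) u i mod 2 ^ level N = digit (2 ^ level N) w (if i = N then N div 2 else i)) \<and>
     digit (2 ^ level (Suc N)) u (N div 2) \<noteq> digit (2 ^ level (Suc N)) u N \<and>
     goedel_positive (goedel_split h) (Suc N) (level (Suc N)) u (level (Suc N)) \<notin> jump A" for u
  define u where "u = undigits (2 ^ level (Suc N)) (Suc N) y"
  have u: "digit (2 ^ level (Suc N)) u i = y i" if "i < Suc N" for i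
    unfolding u_def using that y_less by (intro digit_undigits) auto
  have "P u"
    unfolding P_def goedel_positive_in_jump[OF decC] using y(2) ypos positive_cong[of "Suc N" _ y, OF u]
    by (auto simp: u extensions_mod[OF y(1)] leaf)
  moreover have "u < (2 ^ level (Suc N)) ^ Suc N"
    unfolding u_def using y_less by (rule undigits_less)
  ultimately have "P (bounded_least P ((2 ^ level (Suc N)) ^ Suc N))" by (rule bounded_least)
  moreover have "bounded_least P ((2 ^ level (Suc N)) ^ Suc N) = p2 (state (jump A) (Suc N))"
    by (simp add: st next_word_def P_def[abs_def])
  ultimately have P: "P (p2 (state (jump A) (Suc N)))" by simp
  show "positive_above (split_set C) (Suc N) (level (Suc N)) (leaf A (Suc N)) (level (Suc N))"
    using P unfolding P_def goedel_positive_in_jump[OF decC] leaf_def by blast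
  show "leaf A (Suc N) i mod 2 ^ level N = leaf A N (if i = N then N div 2 else i)" if "i < Suc N"
    using P that unfolding P_def leaf by (simp add: leaf_def)
  show "leaf A (Suc N) (N div 2) \<noteq> leaf A (Suc N) N"
    using P unfolding P_def leaf_def by blast
qed

lemma construction_invariant:
  "0 < N \<Longrightarrow> decides A (p1 (state (jump A) N)) (avoided A N) \<and>
    positive_above (avoided A N) N (level N) (leaf A N) (level N)"
proof (induction N)
  case (Suc N)
  show ?case
  proof (cases "N = 0")
    case True
    \<comment> \<open>State 0 stands for the index 0 of \<open>Zero\<close>, which decides the empty
      set, together with an all-zero string.\<close>
    have "decides A 0 {}"
      unfolding decides_def by (rule exI[of _ Zero]) (simp add: runs.zero prod_encode_def)
    moreover have "state (jump A) (Suc N) = 0" by (simp add: state_def True)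
    ultimately have "decides A (p1 (state (jump A) (Suc N))) {}" by simp
    then show ?thesis
      unfolding avoided_def by (simp add: the_decides positive_empty leaf_less)
  next
    case False
    with Suc have "decides A (p1 (state (jump A) N)) (avoided A N)"
      "positive_above (avoided A N) N (level N) (leaf A N) (level N)" by auto
    from construction_step(2,3)[OF _ this] False show ?thesis
      by (simp add: avoided_def[of A "Suc N"] the_decides)
  qed
qed simp

lemma leaf_not_hit: "0 < N \<Longrightarrow> \<not> hit (avoided A N) N (level N) (leaf A N)"
  by (rule positive_not_hit[OF conjunct2[OF construction_invariant] leaf_less])

context
  fixes A :: "nat set" and N :: nat
  assumes N: "0 < N"
begin

private lemma inv:
  "decides A (p1 (state (jump A) N)) (avoided A N)"
  "positive_above (avoided A N) N (level N) (leaf A N) (level N)"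
  using construction_invariant[OF N] by auto

lemma leaf_Suc: "i < N \<Longrightarrow> leaf A (Suc N) i mod 2 ^ level N = leaf A N i"
  using construction_step(4)[OF N inv, of i] by simp

lemma leaf_new: "leaf A (Suc N) N mod 2 ^ level N = leaf A N (N div 2)"
  using construction_step(4)[OF N inv, of N] by simp

lemma leaf_neq: "leaf A (Suc N) (N div 2) \<noteq> leaf A (Suc N) N"
  by (rule construction_step(5)[OF N inv])

lemma avoided_Suc: "avoided A (Suc N) = split_set (avoided_next A N)"
  using construction_step(1,2)[OF N inv] unfolding avoided_def[of A "Suc N"] avoided_next_def
  by (metis the_decides)

lemma avoided_subset_next: "avoided A N \<subseteq> avoided_next A N"
  using construction_step(1)[OF N inv] unfolding avoided_next_def by (simp add: the_decides)

text \<open>A component this small passes the query by \<open>positive_Un\<close>, so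
  \<open>mid_code\<close> takes it in.\<close>

lemma component_subset_avoided_next:
  assumes "\<And>k. 2 ^ (level N + 1 + level N * N) * card {x \<in> {..<N} \<rightarrow>\<^sub>E {..<2 ^ k}.
      hit (component A (enum_code (p1 N)) (level N + 1 + level N * N)) N k x} \<le> (2 ^ k) ^ N"
  shows "component A (enum_code (p1 N)) (level N + 1 + level N * N) \<subseteq> avoided_next A N"
proof -
  have "positive_above (avoided A N \<union> component A (enum_code (p1 N)) (level N + 1 + level N * N)) N
      (level N) (leaf A N) (level N + 1)"
    by (rule positive_Un[OF inv(2) leaf_less assms])
  with construction_step(1)[OF N inv] show ?thesis
    unfolding avoided_next_def by (simp add: the_decides)
qed

end

section \<open>The construction is primitive recursive in its oracle\<close>

lemma pr_level: "pr F \<Longrightarrow> pr (\<lambda>S x. level (F S x))"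
  unfolding level_def by (intro pr_intros)

lemma pr_goedel_positive:
  "pr F \<Longrightarrow> pr G \<Longrightarrow> pr H \<Longrightarrow> pr I \<Longrightarrow> pr K \<Longrightarrow>
    pr (\<lambda>S x. goedel_positive (F S x) (G S x) (H S x) (I S x) (K S x))"
  unfolding goedel_positive_def by (intro pr_intros pr_goedel_plug pr_goedel_numeral_code)

lemma pr_goedel_union:
  "pr F \<Longrightarrow> pr G \<Longrightarrow> pr H \<Longrightarrow> pr (\<lambda>S x. goedel_union (F S x) (G S x) (H S x))"
  unfolding goedel_union_def by (intro pr_intros pr_goedel_numeral_code)

lemma pr_mid_code:
  "pr F \<Longrightarrow> pr G \<Longrightarrow> pr H \<Longrightarrow> pr (\<lambda>S x. mid_code S (F S x) (G S x) (H S x))"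
  unfolding mid_code_def
  by (intro pr_if pr_query pr_goedel_positive pr_goedel_union pr_enum_goedel pr_level pr_add
    pr_mult pr_p1 pr_const)

lemma pr_next_word:
  assumes "pr F" "pr G" "pr H" shows "pr (\<lambda>S x. next_word S (F S x) (G S x) (H S x))"
proof -
  have "pr (\<lambda>S z. next_word S (p1 z) (p1 (p2 z)) (p2 (p2 z)))"
    unfolding next_word_def by (intro pr_bounded_least pr_intros pr_goedel_positive pr_level pr_digit)
  from pr_comp2[of "\<lambda>S a b. next_word S a (p1 b) (p2 b)", OF this assms(1) pr_pair[OF assms(2,3)]]
  show ?thesis by simp
qed

lemma pr_state: "pr F \<Longrightarrow> pr (\<lambda>S x. state S (F S x))"
  unfolding state_def goedel_split_def
  by (intro pr_rec pr_if pr_eq pr_next_word pr_mid_code pr_goedel_plug pr_basic)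

section \<open>Counting strings in a test\<close>

lemma finite_strings: "finite {\<sigma> :: bool list. length \<sigma> = L \<and> P \<sigma>}"
  by (rule finite_subset[OF _ finite_lists_length_eq[of "UNIV :: bool set" L]]) auto

lemma prob_space_cantor: "prob_space cantor_measure"
  unfolding cantor_measure_def by (intro prob_space_PiM prob_space_measure_pmf)

lemma cylinder:
  assumes "length \<sigma> = L"
  shows "{X. initseg X L = \<sigma>} \<in> sets cantor_measure"
    and "measure cantor_measure {X. initseg X L = \<sigma>} = (1 / 2) ^ L"
proof -
  let ?M = "\<lambda>_::nat. measure_pmf (bernoulli_pmf (1 / 2))"
  interpret product_prob_space ?M UNIV
    by (intro product_prob_spaceI prob_space_measure_pmf)
  have eq: "{X. initseg X L = \<sigma>} = prod_emb UNIV ?M {..<L} (\<Pi>\<^sub>E i\<in>{..<L}. {\<sigma> ! i})"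
    using assms by (intro set_eqI) (auto simp: prod_emb_iff restrict_PiE_iff initseg_def list_eq_iff_nth_eq)
  show "{X. initseg X L = \<sigma>} \<in> sets cantor_measure"
    unfolding eq cantor_measure_def by (intro sets_PiM_I) auto
  have half: "measure (bernoulli_pmf (1 / 2)) {b} = 1 / 2" for b
    by (cases b) (simp_all add: measure_pmf_single)
  show "measure cantor_measure {X. initseg X L = \<sigma>} = (1 / 2) ^ L"
    unfolding eq cantor_measure_def by (subst measure_PiM_emb) (simp_all add: half)
qed

text \<open>The cylinders of these strings are disjoint, lie in \<open>U\<close> and have measure
  \<open>2 ^ -L\<close> each. From here on the argument only counts.\<close>

lemma card_test_strings:
  assumes U: "U = {X. \<exists>k. R (initseg X k)}" and le: "measure cantor_measure U \<le> (1 / 2) ^ n"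
  shows "card {\<sigma>. length \<sigma> = L \<and> (\<exists>k\<le>L. R (take k \<sigma>))} * 2 ^ n \<le> 2 ^ L"
proof -
  interpret prob_space cantor_measure by (rule prob_space_cantor)
  define S where "S = {\<sigma>. length \<sigma> = L \<and> (\<exists>k\<le>L. R (take k \<sigma>))}"
  have "U = (\<Union>k. \<Union>\<sigma>\<in>{\<sigma>. length \<sigma> = k \<and> R \<sigma>}. {X. initseg X k = \<sigma>})"
    unfolding U by (auto simp: initseg_def)
  also have "\<dots> \<in> sets cantor_measure"
  proof (rule sets.countable_UN, rule image_subsetI)
    fix k
    show "(\<Union>\<sigma>\<in>{\<sigma>. length \<sigma> = k \<and> R \<sigma>}. {X. initseg X k = \<sigma>}) \<in> sets cantor_measure"
      by (rule sets.finite_UN[OF finite_strings]) (auto intro: cylinder(1))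
  qed
  finally have meas: "U \<in> sets cantor_measure" .
  have fin: "finite S" unfolding S_def by (rule finite_strings)
  have "measure cantor_measure (\<Union>\<sigma>\<in>S. {X. initseg X L = \<sigma>}) =
      (\<Sum>\<sigma>\<in>S. measure cantor_measure {X. initseg X L = \<sigma>})"
    using fin cylinder(1) by (intro finite_measure_finite_Union) (auto simp: S_def disjoint_family_on_def)
  also have "\<dots> = card S * (1 / 2) ^ L" by (simp add: cylinder(2) S_def)
  finally have "card S * (1 / 2) ^ L = measure cantor_measure (\<Union>\<sigma>\<in>S. {X. initseg X L = \<sigma>})" ..
  also have "\<dots> \<le> measure cantor_measure U"
  proof (rule finite_measure_mono[OF _ meas])
    show "(\<Union>\<sigma>\<in>S. {X. initseg X L = \<sigma>}) \<subseteq> U"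
    proof clarsimp
      fix X assume "initseg X L \<in> S"
      then obtain k where "k \<le> L" "R (take k (initseg X L))" by (auto simp: S_def)
      moreover from this have "take k (initseg X L) = initseg X k" by (simp add: initseg_def take_map)
      ultimately show "X \<in> U" unfolding U by auto
    qed
  qed
  finally have "real (card S) * (1 / 2) ^ L \<le> (1 / 2) ^ n" using le by simp
  then have "real (card S * 2 ^ n) \<le> real (2 ^ L)"
    by (simp add: power_divide divide_simps split: if_splits)
  then show ?thesis unfolding S_def of_nat_le_iff .
qed

section \<open>Bits of tuples read by a join\<close>

lemma bits_inj:
  assumes "x < 2 ^ k" "y < 2 ^ k" "\<And>j. j < k \<Longrightarrow> odd (x div 2 ^ j) = odd (y div 2 ^ j)"
  shows "x = (y::nat)"
proof -
  have "take_bit k x = take_bit k y"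
    by (intro bit_eqI, unfold bit_take_bit_iff, unfold bit_iff_odd) (use assms(3) in auto)
  with assms(1,2) show ?thesis by (simp add: take_bit_eq_mod)
qed

lemma even_mod_div: "j < k \<Longrightarrow> even ((x::nat) mod 2 ^ k div 2 ^ j) = even (x div 2 ^ j)"
  using bit_take_bit_iff[of k x j] by (simp add: bit_iff_odd take_bit_eq_mod)

text \<open>
  The joins considered below read position \<open>q t\<close> of sequence \<open>a t\<close> at time \<open>t\<close>; with the sequences
  taken from the tuple \<open>x\<close> by \<open>f\<close> this gives the following string.
\<close>

definition word :: "(nat \<Rightarrow> nat) \<Rightarrow> (nat \<Rightarrow> nat) \<Rightarrow> (nat \<Rightarrow> nat) \<Rightarrow> nat \<Rightarrow> (nat \<Rightarrow> nat) \<Rightarrow> bool list" where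
  "word a q f L x = map (\<lambda>t. odd (x (f (a t)) div 2 ^ q t)) [0..<L]"

text \<open>The word reads \<open>k\<close> of the \<open>N * k\<close> bits of a tuple: different
  times read different places, and \<open>q t \<le> t\<close> keeps the positions below
  \<open>k\<close>. The remaining bits determine the tuple.\<close>

lemma card_word_fibre:
  assumes f: "\<And>j. j < p \<Longrightarrow> f j < N" "inj_on f {..<p}"
    and aq: "\<And>t. a t < p" "\<And>t. q t \<le> t" "inj (\<lambda>t. (a t, q t))"
  shows "card {x \<in> {..<N} \<rightarrow>\<^sub>E {..<2 ^ k}. word a q f k x = \<sigma>} * 2 ^ k \<le> (2 ^ k) ^ N"
proof -
  define D where "D = {..<N} \<times> {..<k}"
  define \<iota> where "\<iota> t = (f (a t), q t)" for t
  define I where "I = \<iota> ` {..<k}"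
  define F where "F = {x \<in> {..<N} \<rightarrow>\<^sub>E {..<2 ^ k}. word a q f k x = \<sigma>}"
  have ID: "I \<subseteq> D" using f(1) aq(1,2) by (auto simp: I_def D_def \<iota>_def intro: le_less_trans)
  have "inj \<iota>"
  proof (rule injI)
    fix s t assume "\<iota> s = \<iota> t"
    then have "a s = a t" "q s = q t" using inj_onD[OF f(2)] aq(1) by (auto simp: \<iota>_def)
    then show "s = t" using injD[OF aq(3), of s t] by simp
  qed
  then have cI: "card I = k" by (simp add: I_def card_image inj_on_subset)
  let ?g = "\<lambda>x. restrict (\<lambda>(i, j). odd (x i div 2 ^ j)) (D - I)"
  have "inj_on ?g F"
  proof (rule inj_onI)
    fix x y assume x: "x \<in> F" and y: "y \<in> F" and eq: "?g x = ?g y"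
    have "x i = y i" for i
    proof (cases "i < N")
      case True
      show ?thesis
      proof (rule bits_inj[of _ k])
        show "x i < 2 ^ k" "y i < 2 ^ k" using x y True by (auto simp: F_def)
        fix j assume j: "j < k"
        show "odd (x i div 2 ^ j) = odd (y i div 2 ^ j)"
        proof (cases "(i, j) \<in> I")
          case True
          then obtain t where t: "t < k" "f (a t) = i" "q t = j" by (auto simp: I_def \<iota>_def)
          have "word a q f k x ! t = word a q f k y ! t" using x y by (simp add: F_def)
          with t show ?thesis by (simp add: word_def)
        next
          case False
          with fun_cong[OF eq, of "(i, j)"] True j show ?thesis by (simp add: D_def)
        qed
      qed
    next
      case False
      then show ?thesis using x y by (auto simp: F_def PiE_iff extensional_def)
    qed
    then show "x = y" by blast
  qed
  moreover have "?g ` F \<subseteq> (D - I) \<rightarrow>\<^sub>E (UNIV :: bool set)" by auto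
  moreover have fin: "finite (D - I)" by (simp add: D_def)
  then have "finite ((D - I) \<rightarrow>\<^sub>E (UNIV :: bool set))" by (intro finite_PiE) auto
  ultimately have "card F \<le> card ((D - I) \<rightarrow>\<^sub>E (UNIV :: bool set))" by (rule card_inj_on_le)
  also have "\<dots> = 2 ^ (card D - k)"
    using fin ID cI finite_subset[OF ID] by (simp add: card_PiE card_Diff_subset D_def)
  finally have "card F * 2 ^ k \<le> 2 ^ (card D - k) * 2 ^ k" by simp
  also have "\<dots> = 2 ^ card D"
    using card_mono[OF _ ID] cI by (simp add: power_add[symmetric] D_def)
  also have "\<dots> = (2 ^ k) ^ N" by (simp add: D_def power_mult[symmetric] mult.commute)
  finally show ?thesis by (simp add: F_def)
qed

text \<open>The level of the test is raised by \<open>p * N\<close> to pay for the at most \<open>N ^ p\<close> choices of \<open>f\<close>.\<close>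

lemma card_tuples_in_test:
  assumes aq: "\<And>t. a t < p" "\<And>t. q t \<le> t" "inj (\<lambda>t. (a t, q t))"
    and R: "\<And>L. card {\<sigma>. length \<sigma> = L \<and> (\<exists>k\<le>L. R (take k \<sigma>))} * 2 ^ (m + p * N) \<le> 2 ^ L"
    and N: "0 < N"
  shows "2 ^ m * card {x \<in> {..<N} \<rightarrow>\<^sub>E {..<2 ^ k}.
      \<exists>u<N ^ p. inj_on (digit N u) {..<p} \<and> (\<exists>L\<le>k. R (word a q (digit N u) L x))} \<le> (2 ^ k) ^ N"
proof -
  let ?C = "{..<N} \<rightarrow>\<^sub>E {..<(2::nat) ^ k}"
  have finC: "finite ?C" by (intro finite_PiE) auto
  \<comment> \<open>\<open>u < N ^ p\<close> codes a choice of coordinates by its digits to base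
    \<open>N\<close>.\<close>
  define V where "V = {u. u < N ^ p \<and> inj_on (digit N u) {..<p}}"
  define S where "S = {\<sigma>. length \<sigma> = k \<and> (\<exists>L\<le>k. R (take L \<sigma>))}"
  define Fu where "Fu u = {x \<in> ?C. word a q (digit N u) k x \<in> S}" for u
  have finS: "finite S" unfolding S_def by (rule finite_strings)
  have V: "finite V" "card V \<le> N ^ p"
    using card_mono[of "{..<N ^ p}" V] by (auto simp: V_def)
  have "{x \<in> ?C. \<exists>u<N ^ p. inj_on (digit N u) {..<p} \<and> (\<exists>L\<le>k. R (word a q (digit N u) L x))} \<subseteq> (\<Union>u\<in>V. Fu u)"
  proof clarify
    fix x u L assume x: "x \<in> ?C" "u < N ^ p" "inj_on (digit N u) {..<p}" "L \<le> k" "R (word a q (digit N u) L x)"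
    then have "word a q (digit N u) L x = take L (word a q (digit N u) k x)"
      by (simp add: word_def take_map)
    with x show "x \<in> (\<Union>u\<in>V. Fu u)" by (auto simp: V_def Fu_def S_def word_def)
  qed
  then have 1: "card {x \<in> ?C. \<exists>u<N ^ p. inj_on (digit N u) {..<p} \<and> (\<exists>L\<le>k. R (word a q (digit N u) L x))}
      \<le> (\<Sum>u\<in>V. card (Fu u))"
    using V(1) finC by (intro le_trans[OF card_mono card_UN_le]) (auto simp: Fu_def)
  have 2: "2 ^ (m + p * N) * card (Fu u) \<le> (2 ^ k) ^ N" if u: "u \<in> V" for u
  proof -
    have Fu: "Fu u = (\<Union>\<sigma>\<in>S. {x \<in> ?C. word a q (digit N u) k x = \<sigma>})" by (auto simp: Fu_def)
    have "card (Fu u) \<le> (\<Sum>\<sigma>\<in>S. card {x \<in> ?C. word a q (digit N u) k x = \<sigma>})"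
      unfolding Fu by (rule card_UN_le[OF finS])
    then have "card (Fu u) * 2 ^ k \<le> (\<Sum>\<sigma>\<in>S. card {x \<in> ?C. word a q (digit N u) k x = \<sigma>} * 2 ^ k)"
      by (simp add: sum_distrib_right[symmetric])
    also have "\<dots> \<le> (\<Sum>\<sigma>\<in>S. (2 ^ k) ^ N)"
      using u N by (intro sum_mono card_word_fibre[OF _ _ aq]) (auto simp: V_def digit_less)
    finally have "card (Fu u) * 2 ^ k \<le> card S * (2 ^ k) ^ N" by simp
    then have "card (Fu u) * 2 ^ k * 2 ^ (m + p * N) \<le> card S * (2 ^ k) ^ N * 2 ^ (m + p * N)" by simp
    also have "\<dots> \<le> 2 ^ k * (2 ^ k) ^ N"
      using R[of k] unfolding S_def[symmetric] by (metis mult.assoc mult.commute mult_le_mono1)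
    finally have "2 ^ k * (2 ^ (m + p * N) * card (Fu u)) \<le> 2 ^ k * (2 ^ k) ^ N" by (simp only: mult_ac)
    then show ?thesis by simp
  qed
  have "2 ^ (p * N) * (2 ^ m * (\<Sum>u\<in>V. card (Fu u))) = (\<Sum>u\<in>V. 2 ^ (m + p * N) * card (Fu u))"
    by (simp add: power_add sum_distrib_left mult_ac)
  also have "\<dots> \<le> (\<Sum>u\<in>V. (2 ^ k) ^ N)" by (intro sum_mono 2)
  also have "\<dots> \<le> N ^ p * (2 ^ k) ^ N" using V(2) by simp
  also have "\<dots> \<le> 2 ^ (p * N) * (2 ^ k) ^ N"
  proof -
    have "N ^ p \<le> (2 ^ N) ^ p" by (intro power_mono) (auto intro: less_imp_le less_exp)
    then show ?thesis by (simp add: power_mult[symmetric] mult.commute)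
  qed
  finally have "2 ^ m * (\<Sum>u\<in>V. card (Fu u)) \<le> (2 ^ k) ^ N" by simp
  with 1 show ?thesis by (meson le_trans mult_le_mono2)
qed

section \<open>The tree and its paths\<close>

text \<open>The leading 1 makes the index injective. Index 0 is the single string of stage 1 and
  belongs to no node.\<close>

definition heap_index :: "bool list \<Rightarrow> nat" where
  "heap_index \<sigma> = foldl (\<lambda>h b. 2 * h + of_bool b) 1 \<sigma>"

definition bits :: "nat \<Rightarrow> nat \<Rightarrow> bool list" where
  "bits L v = map (\<lambda>t. odd (v div 2 ^ t)) [0..<L]"

text \<open>String \<open>j > 0\<close> is doubled when strings \<open>2 * j\<close> and \<open>2 * j + 1\<close> are created, as in a binary heap.\<close>

definition random_tree :: "nat set \<Rightarrow> bool list \<Rightarrow> bool list" where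
  "random_tree A \<sigma> = bits (level (Suc (heap_index \<sigma>))) (leaf A (Suc (heap_index \<sigma>)) (heap_index \<sigma>))"

lemma heap_simps [simp]: "heap_index [] = 1" "heap_index (\<sigma> @ [b]) = 2 * heap_index \<sigma> + of_bool b"
  by (simp_all add: heap_index_def)

lemma heap_gt: "length \<sigma> < heap_index \<sigma>"
  by (induction \<sigma> rule: rev_induct) auto

lemma heap_pos: "0 < heap_index \<sigma>"
  using heap_gt[of \<sigma>] by simp

lemma heap_neq_0 [simp]: "heap_index \<sigma> \<noteq> 0"
  using heap_pos[of \<sigma>] by simp

lemma heap_inj: "heap_index \<sigma> = heap_index \<tau> \<Longrightarrow> \<sigma> = \<tau>"
proof (induction \<sigma> arbitrary: \<tau> rule: rev_induct)
  case Nil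
  then show ?case by (cases \<tau> rule: rev_cases) (auto simp: of_bool_def split: if_splits)
next
  case (snoc b \<sigma>)
  show ?case
  proof (cases \<tau> rule: rev_cases)
    case Nil
    with snoc.prems heap_pos[of \<sigma>] show ?thesis by (auto simp: of_bool_def split: if_splits)
  next
    case (snoc \<rho> c)
    with snoc.prems have *: "2 * heap_index \<sigma> + of_bool b = 2 * heap_index \<rho> + of_bool c" by simp
    then have "heap_index \<sigma> = heap_index \<rho>" "b = c" by (cases b; cases c; simp; presburger)+
    with snoc snoc.IH show ?thesis by simp
  qed
qed

lemma level_mono: "M \<le> N \<Longrightarrow> level M \<le> level N"
  by (simp add: level_def)

lemma level_strict_mono: "M < N \<Longrightarrow> level M < level N"
  by (simp add: level_def)

lemma level_gt: "N < level N"
  by (simp add: level_def less_exp[THEN less_le_trans] power_mono)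

lemma leaf_stable:
  assumes "0 < M" "M \<le> N" "i < M" shows "leaf A N i mod 2 ^ level M = leaf A M i"
  using assms(2)
proof (induction N rule: dec_induct)
  case base
  show ?case by (simp add: leaf_less)
next
  case (step N)
  have "leaf A (Suc N) i mod 2 ^ level M = leaf A (Suc N) i mod 2 ^ level N mod 2 ^ level M"
    using step.hyps by (simp add: mod_power_mod level_mono)
  also have "\<dots> = leaf A M i"
    using step assms by (subst leaf_Suc) auto
  finally show ?case .
qed

lemma prefix_bits: "L \<le> M \<Longrightarrow> v mod 2 ^ L = u \<Longrightarrow> prefix (bits L u) (bits M v)"
proof -
  assume "L \<le> M" "v mod 2 ^ L = u"
  then have "bits L u = take L (bits M v)"
    by (auto simp: bits_def take_map even_mod_div intro!: nth_equalityI)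
  then show ?thesis by (metis take_is_prefix)
qed

lemma strict_prefix_bits: "L < M \<Longrightarrow> v mod 2 ^ L = u \<Longrightarrow> strict_prefix (bits L u) (bits M v)"
  using prefix_bits[of L M v u] by (auto simp: strict_prefix_def bits_def dest: arg_cong[where f = length])

lemma parallel_bits:
  assumes "L \<le> M" "u < 2 ^ L" "v mod 2 ^ L \<noteq> u" shows "bits L u \<parallel> bits M v"
proof -
  have "bits L (v mod 2 ^ L) \<noteq> bits L u"
  proof
    assume eq: "bits L (v mod 2 ^ L) = bits L u"
    have "odd (v mod 2 ^ L div 2 ^ j) = odd (u div 2 ^ j)" if "j < L" for j
      using arg_cong[OF eq, of "\<lambda>l. l ! j"] that by (simp add: bits_def)
    then show False using bits_inj[of "v mod 2 ^ L" L u] assms(2,3) by simp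
  qed
  moreover have "prefix (bits L (v mod 2 ^ L)) (bits M v)" using assms(1) by (simp add: prefix_bits)
  moreover have "length (bits L (v mod 2 ^ L)) = length (bits L u)" by (simp add: bits_def)
  ultimately show ?thesis
    using assms(1) by (metis not_equal_is_parallel parallelD1 parallelD2 parallelI prefix_same_cases prefix_order.trans)
qed

lemma perfect_random_tree: "perfect_tree (random_tree A)"
  unfolding perfect_tree_def
proof (intro allI conjI)
  fix \<sigma>
  define h where "h = heap_index \<sigma>"
  have h: "0 < h" "Suc h \<le> 2 * h" "Suc h < Suc (2 * h)" "h < 2 * h" using heap_pos[of \<sigma>] by (auto simp: h_def)
  have lev: "level (Suc h) < level (Suc (2 * h))" "level (Suc h) < level (Suc (Suc (2 * h)))"
    "level (Suc (2 * h)) \<le> level (Suc (Suc (2 * h)))"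
    using h by (auto intro!: level_strict_mono level_mono)
  have new0: "leaf A (Suc (2 * h)) (2 * h) mod 2 ^ level (2 * h) = leaf A (2 * h) h"
    using leaf_new[of "2 * h" A] h by simp
  have new1: "leaf A (Suc (Suc (2 * h))) (Suc (2 * h)) mod 2 ^ level (Suc (2 * h)) = leaf A (Suc (2 * h)) h"
    using leaf_new[of "Suc (2 * h)" A] h by simp
  have "leaf A (Suc (2 * h)) (2 * h) mod 2 ^ level (Suc h) = leaf A (2 * h) h mod 2 ^ level (Suc h)"
    using h by (simp add: new0[symmetric] mod_power_mod level_mono)
  also have "\<dots> = leaf A (Suc h) h" using h by (intro leaf_stable) auto
  finally show "strict_prefix (random_tree A \<sigma>) (random_tree A (\<sigma> @ [False]))"
    using lev by (simp add: random_tree_def h_def[symmetric] strict_prefix_bits)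
  have "leaf A (Suc (Suc (2 * h))) (Suc (2 * h)) mod 2 ^ level (Suc h) = leaf A (Suc (2 * h)) h mod 2 ^ level (Suc h)"
    using h by (simp add: new1[symmetric] mod_power_mod level_mono)
  also have "\<dots> = leaf A (Suc h) h" using h by (intro leaf_stable) auto
  finally show "strict_prefix (random_tree A \<sigma>) (random_tree A (\<sigma> @ [True]))"
    using lev by (simp add: random_tree_def h_def[symmetric] strict_prefix_bits)
  \<comment> \<open>String \<open>2 * h\<close> is separated from string \<open>h\<close> when it is
    created, and only from then on does string \<open>2 * h + 1\<close> extend string
    \<open>h\<close>.\<close>
  have "leaf A (Suc (2 * h)) h \<noteq> leaf A (Suc (2 * h)) (2 * h)"
    using leaf_neq[of "2 * h" A] h by simp
  then show "random_tree A (\<sigma> @ [False]) \<parallel> random_tree A (\<sigma> @ [True])"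
    using lev by (simp add: random_tree_def h_def[symmetric] parallel_bits new1 leaf_less)
qed

text \<open>The code of a nonempty list is the successor of a pair, hence \<open>p2 z - 1\<close>.
  The code 0 of the empty list is left alone, so the code itself can serve as the number of
  steps.\<close>

definition heap_step :: "nat \<Rightarrow> nat" where
  "heap_step z = (if p2 z = 0 then z else prod_encode (2 * p1 z + p1 (p2 z - 1), p2 (p2 z - 1)))"

lemma heap_code: "heap_index \<sigma> = p1 ((heap_step ^^ str_code \<sigma>) (prod_encode (1, str_code \<sigma>)))"
proof -
  have "length \<sigma> \<le> n \<Longrightarrow> (heap_step ^^ n) (prod_encode (h, str_code \<sigma>)) =
      prod_encode (foldl (\<lambda>h b. 2 * h + of_bool b) h \<sigma>, 0)" for n h \<sigma>
  proof (induction \<sigma> arbitrary: n h)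
    case Nil
    have "heap_step (prod_encode (h, 0)) = prod_encode (h, 0)" by (simp add: heap_step_def)
    then show ?case by (induction n) (simp_all add: str_code_def)
  next
    case (Cons b \<sigma>)
    then obtain m where "n = Suc m" "length \<sigma> \<le> m" by (cases n) auto
    moreover have "heap_step (prod_encode (h, str_code (b # \<sigma>))) = prod_encode (2 * h + of_bool b, str_code \<sigma>)"
      by (simp add: heap_step_def str_code_def)
    ultimately show ?case using Cons.IH by (simp add: funpow_Suc_right del: funpow.simps)
  qed
  moreover have "length \<sigma> \<le> str_code \<sigma>"
  proof (induction \<sigma>)
    case (Cons b \<sigma>)
    then show ?case using le_prod_encode_2[of "str_code \<sigma>" "of_bool b"] by (simp add: str_code_def)
  qed (simp add: str_code_def)
  ultimately show ?thesis by (simp add: heap_index_def)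
qed

lemma str_code_map: "str_code (map (\<lambda>t. odd (f t)) xs) = list_encode (map (\<lambda>t. f t mod 2) xs)"
  by (simp add: str_code_def comp_def of_bool_odd_eq_mod_2)

lemma computable_random_tree: "computable_tree (jump A) (random_tree A)"
proof -
  define G where "G y = p1 ((heap_step ^^ y) (prod_encode (1, y)))" for y
  have "(f ^^ n) z = rec_nat z (\<lambda>_. f) n" for f :: "nat \<Rightarrow> nat" and n z by (induction n) auto
  then have G: "pr F \<Longrightarrow> pr (\<lambda>S x. G (F S x))" for F
    unfolding G_def heap_step_def by (simp only:) (intro pr_rec pr_intros)
  have "pr (\<lambda>S y. list_encode (map (\<lambda>t. digit (2 ^ level (Suc (G y))) (p2 (state S (Suc (G y)))) (G y) div 2 ^ t mod 2)
      [0..<level (Suc (G y))]))"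
    by (intro pr_list_encode pr_intros pr_digit pr_level pr_state G)
  then obtain c where c: "\<And>S y. runs S c y (list_encode (map (\<lambda>t. digit (2 ^ level (Suc (G y))) (p2 (state S (Suc (G y)))) (G y) div 2 ^ t mod 2)
      [0..<level (Suc (G y))]))"
    unfolding pr_def by blast
  have "G (str_code \<sigma>) = heap_index \<sigma>" for \<sigma> unfolding G_def heap_code ..
  then have "runs (jump A) c (str_code \<sigma>) (str_code (random_tree A \<sigma>))" for \<sigma>
    using c[of "jump A" "str_code \<sigma>"] by (simp add: random_tree_def bits_def str_code_map leaf_def)
  then show ?thesis unfolding computable_tree_def by blast
qed

text \<open>The string through which a path runs at each stage.\<close>

primrec ancestor :: "(nat \<Rightarrow> bool) \<Rightarrow> nat \<Rightarrow> nat" where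
  "ancestor Z 0 = 1"
| "ancestor Z (Suc N) = (if N \<in> range (\<lambda>n. heap_index (initseg Z n)) then N else ancestor Z N)"

lemma initseg_Suc: "initseg Z (Suc n) = initseg Z n @ [Z n]"
  by (simp add: initseg_def)

lemma strict_mono_heap: "strict_mono (\<lambda>n. heap_index (initseg Z n))"
  unfolding strict_mono_Suc_iff using heap_pos by (simp add: initseg_Suc trans_less_add1)

lemma heap_le_iff: "heap_index (initseg Z i) \<le> heap_index (initseg Z j) \<longleftrightarrow> i \<le> j"
  using strict_mono_less_eq[OF strict_mono_heap] .

lemma ancestor:
  assumes "2 \<le> N"
  shows "ancestor Z N \<in> range (\<lambda>n. heap_index (initseg Z n))" "ancestor Z N < N"
    "heap_index (initseg Z n) < N \<Longrightarrow> heap_index (initseg Z n) \<le> ancestor Z N"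
proof -
  have "ancestor Z N \<in> range (\<lambda>n. heap_index (initseg Z n)) \<and> ancestor Z N < N \<and>
      (\<forall>n. heap_index (initseg Z n) < N \<longrightarrow> heap_index (initseg Z n) \<le> ancestor Z N)"
    using assms
  proof (induction N rule: dec_induct)
    case base
    have "1 \<in> range (\<lambda>n. heap_index (initseg Z n))" by (rule range_eqI[of _ _ 0]) (simp add: initseg_def)
    then have "ancestor Z 2 = 1" by (simp add: numeral_2_eq_2)
    then show ?case using \<open>1 \<in> range (\<lambda>n. heap_index (initseg Z n))\<close> by auto
  next
    case (step N)
    then show ?case by (auto simp: less_Suc_eq)
  qed
  then show "ancestor Z N \<in> range (\<lambda>n. heap_index (initseg Z n))" "ancestor Z N < N"
    "heap_index (initseg Z n) < N \<Longrightarrow> heap_index (initseg Z n) \<le> ancestor Z N" by auto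
qed

text \<open>The nodes of a path have increasing indices, so the last one before \<open>N\<close> is
  the parent of \<open>N\<close>, and this is the string doubled at stage \<open>N\<close>.\<close>

lemma ancestor_parent:
  assumes N: "2 \<le> N" and "N \<in> range (\<lambda>n. heap_index (initseg Z n))"
  shows "ancestor Z N = N div 2"
proof -
  obtain n where n: "N = heap_index (initseg Z n)" using assms(2) by blast
  with N have "n \<noteq> 0" by (intro notI) (simp add: initseg_def)
  then obtain m where m: "n = Suc m" by (cases n) auto
  have d: "N div 2 = heap_index (initseg Z m)" by (simp add: n m initseg_Suc)
  obtain k where k: "ancestor Z N = heap_index (initseg Z k)" using ancestor(1)[OF N] by blast
  have "\<not> heap_index (initseg Z n) \<le> heap_index (initseg Z k)" using ancestor(2)[OF N, of Z] k n by simp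
  then have "ancestor Z N \<le> N div 2" unfolding k d heap_le_iff m by simp
  moreover have "N div 2 \<le> ancestor Z N" using ancestor(3)[OF N, of Z m] N by (simp add: d[symmetric])
  ultimately show ?thesis by simp
qed

lemma ancestor_eventually_neq:
  assumes "Z \<noteq> Z'" shows "\<forall>\<^sub>F N in sequentially. ancestor Z N \<noteq> ancestor Z' N"
proof -
  obtain n where n: "Z n \<noteq> Z' n" using assms by blast
  define K where "K = heap_index (initseg Z (Suc n)) + heap_index (initseg Z' (Suc n)) + 2"
  have "ancestor Z N \<noteq> ancestor Z' N" if "K \<le> N" for N
  proof
    assume eq: "ancestor Z N = ancestor Z' N"
    have N: "2 \<le> N" using that by (simp add: K_def)
    obtain i j where i: "ancestor Z N = heap_index (initseg Z i)" and j: "ancestor Z' N = heap_index (initseg Z' j)"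
      using ancestor(1)[OF N] by blast
    have "initseg Z i = initseg Z' j" using eq i j heap_inj by simp
    moreover have "heap_index (initseg Z (Suc n)) \<le> heap_index (initseg Z i)"
      using that ancestor(3)[OF N, of Z "Suc n"] by (simp add: i K_def)
    then have "n < i" by (simp add: heap_le_iff Suc_le_eq)
    ultimately have "initseg Z i ! n = initseg Z' j ! n" "length (initseg Z i) = length (initseg Z' j)" by auto
    with \<open>n < i\<close> n show False by (simp add: initseg_def)
  qed
  then show ?thesis unfolding eventually_sequentially by blast
qed

lemma leaf_ancestor_stable:
  assumes "2 \<le> M" "M \<le> N"
  shows "leaf A N (ancestor Z N) mod 2 ^ level M = leaf A M (ancestor Z M)"
  using assms(2)
proof (induction N rule: dec_induct)
  case base
  show ?case by (simp add: leaf_less)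
next
  case (step N)
  have "leaf A (Suc N) (ancestor Z (Suc N)) mod 2 ^ level N = leaf A N (ancestor Z N)"
    using step.hyps assms(1) ancestor(2)[of N Z]
    by (auto simp: leaf_new leaf_Suc ancestor_parent)
  then have "leaf A (Suc N) (ancestor Z (Suc N)) mod 2 ^ level N mod 2 ^ level M = leaf A M (ancestor Z M)"
    using step.IH by simp
  then show ?case using step.hyps by (simp add: mod_power_mod level_mono)
qed

lemma tree_path_bit:
  assumes N: "2 \<le> N" and t: "t < level N"
  shows "tree_path (random_tree A) Z t = odd (leaf A N (ancestor Z N) div 2 ^ t)"
proof -
  \<comment> \<open>This node of the path is created after stage \<open>N\<close>, so its string is
    long enough to contain position \<open>t\<close>.\<close>
  define h where "h = heap_index (initseg Z N)"
  have h: "N < h" using heap_gt[of "initseg Z N"] by (simp add: h_def initseg_def)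
  then have t': "t < level (Suc h)" using t level_mono[of N "Suc h"] by simp
  have "ancestor Z (Suc h) = h" by (auto simp: h_def)
  then have "leaf A (Suc h) h mod 2 ^ level N = leaf A N (ancestor Z N)"
    using leaf_ancestor_stable[OF N, of "Suc h" A Z] h by simp
  moreover have "initseg (tree_path (random_tree A) Z) (level (Suc h)) = bits (level (Suc h)) (leaf A (Suc h) h)"
    using initseg_tree_path[OF perfect_random_tree, of A Z N] by (simp add: random_tree_def h_def bits_def)
  then have "tree_path (random_tree A) Z t = odd (leaf A (Suc h) h div 2 ^ t)"
    using t' by (simp add: initseg_def bits_def)
  ultimately show ?thesis using even_mod_div[OF t, of "leaf A (Suc h) h"] by simp
qed

lemma hit_avoided_Suc:
  assumes "0 < N" "G = id \<or> G = (\<lambda>m. if m = N div 2 then N else m)" "hit (avoided_next A N) N k (x \<circ> G)"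
  shows "hit (avoided A (Suc N)) (Suc N) k x"
  using assms by (auto simp: avoided_Suc hit_split_set comp_def)

text \<open>Keeping the old copies, the choice \<open>id\<close>, would carry such a hit over to
  stage \<open>N + 1\<close>.\<close>

lemma leaf_not_hit_next:
  assumes "0 < N" shows "\<not> hit (avoided_next A N) N (level N) (leaf A N)"
proof
  assume "hit (avoided_next A N) N (level N) (leaf A N)"
  then have "hit (avoided_next A N) N (level N) (\<lambda>i. leaf A (Suc N) i mod 2 ^ level N)"
    using hit_cong[of N "leaf A N" "\<lambda>i. leaf A (Suc N) i mod 2 ^ level N"] leaf_Suc[OF assms] by simp
  then have "hit (avoided_next A N) N (level N) (leaf A (Suc N))" by (simp add: hit_mod)
  then have "hit (avoided A (Suc N)) (Suc N) (level N) (leaf A (Suc N))"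
    using hit_avoided_Suc[OF assms, of id] by simp
  from hit_level_mono[OF level_mono this] show False using leaf_not_hit[of "Suc N" A] by simp
qed

text \<open>At most one of finitely many separated paths runs through the string doubled at a given stage.\<close>

lemma avoided_descend:
  assumes "2 \<le> N" "N \<le> M" and dist: "\<And>K Z Z'. N \<le> K \<Longrightarrow> Z \<in> P \<Longrightarrow> Z' \<in> P \<Longrightarrow> Z \<noteq> Z' \<Longrightarrow> ancestor Z K \<noteq> ancestor Z' K"
  shows "\<exists>F. (\<forall>Z\<in>P. F (ancestor Z N) = ancestor Z M) \<and>
    (\<forall>k x. hit (avoided_next A N) N k (x \<circ> F) \<longrightarrow> hit (avoided_next A M) M k x)"
  using assms(2)
proof (induction M rule: dec_induct)
  case base
  show ?case by (rule exI[of _ id]) simp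
next
  case (step M)
  then obtain F where F: "\<And>Z. Z \<in> P \<Longrightarrow> F (ancestor Z N) = ancestor Z M"
    "\<And>k x. hit (avoided_next A N) N k (x \<circ> F) \<Longrightarrow> hit (avoided_next A M) M k x" by blast
  have M: "2 \<le> M" using step assms(1) by simp
  \<comment> \<open>\<open>G\<close> moves to the new copy exactly when some path in
    \<open>P\<close> does; \<open>split_set\<close> covers both choices.\<close>
  obtain G where G: "G = id \<or> G = (\<lambda>m. if m = M div 2 then M else m)"
    "\<And>Z. Z \<in> P \<Longrightarrow> G (ancestor Z M) = ancestor Z (Suc M)"
  proof (cases "\<exists>Z\<in>P. M \<in> range (\<lambda>n. heap_index (initseg Z n))")
    case True
    then obtain Z where Z: "Z \<in> P" "M \<in> range (\<lambda>n. heap_index (initseg Z n))" by blast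
    have "(if ancestor Z' M = M div 2 then M else ancestor Z' M) = ancestor Z' (Suc M)" if "Z' \<in> P" for Z'
    proof (cases "Z' = Z")
      case True with Z M show ?thesis by (simp add: ancestor_parent)
    next
      case False
      then have "ancestor Z' M \<noteq> M div 2"
        using dist[of M Z' Z] step.hyps that Z M by (simp add: ancestor_parent)
      then show ?thesis using ancestor_parent[OF M, of Z'] by auto
    qed
    then show ?thesis using that by blast
  next
    case False
    then show ?thesis using that[of id] by auto
  qed
  have "hit (avoided_next A (Suc M)) (Suc M) k x" if "hit (avoided_next A N) N k (x \<circ> (G \<circ> F))" for k x
  proof -
    have "hit (avoided_next A M) M k (x \<circ> G)" using F(2)[of k "x \<circ> G"] that by (simp add: comp_assoc)
    then show ?thesis
      using hit_avoided_Suc[OF _ G(1)] M hit_mono[OF avoided_subset_next] by (metis gr0I not_numeral_le_zero zero_less_Suc)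
  qed
  moreover have "(G \<circ> F) (ancestor Z N) = ancestor Z (Suc M)" if "Z \<in> P" for Z
    unfolding comp_apply F(1)[OF that] by (rule G(2)[OF that])
  ultimately show ?case by blast
qed

section \<open>Randomness of the joins\<close>

text \<open>Time \<open>t\<close> reads position \<open>q t\<close> of path \<open>a t\<close>. This
  form covers single joins as well as joins of two joins, whose lists may differ in length.\<close>

lemma ml_random_join:
  assumes Ws: "distinct Ws" "set Ws \<subseteq> paths (random_tree A)"
    and a: "pr (\<lambda>S. a)" and q: "pr (\<lambda>S. q)"
    and aq: "\<And>t. a t < length Ws" "\<And>t. q t \<le> t" "inj (\<lambda>t. (a t, q t))"
  shows "ml_random A (\<lambda>t. (Ws ! a t) (q t))"
  unfolding ml_random_def
proof (intro allI impI notI)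
  fix U assume test: "ml_test A U" and X_in: "(\<lambda>t. (Ws ! a t) (q t)) \<in> (\<Inter>n. U n)"
  define X where "X = (\<lambda>t. (Ws ! a t) (q t))"
  define p where "p = length Ws"
  obtain R c where c: "\<And>n \<sigma>. runs A c (prod_encode (n, str_code \<sigma>)) (of_bool (R n \<sigma>))"
    and U: "\<And>n. U n = {X. \<exists>k. R n (initseg X k)}"
    using test unfolding ml_test_def uniformly_Sigma1_def by blast
  have R: "card {\<sigma>. length \<sigma> = L \<and> (\<exists>k\<le>L. R n (take k \<sigma>))} * 2 ^ n \<le> 2 ^ L" for n L
    using test by (intro card_test_strings[OF U]) (simp add: ml_test_def)
  \<comment> \<open>All injective choices of \<open>p\<close> coordinates are tried, and the level
    is raised as in \<open>card_tuples_in_test\<close>. The value 2 means that \<open>c\<close>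
    outputs 1 within fuel \<open>k\<close>.\<close>
  define e where "e S z = (let m = p1 z; N = p1 (p2 z); k = p1 (p2 (p2 z)); w = p2 (p2 (p2 z)) in
    of_bool (\<exists>u<N ^ p. (\<forall>j<p. \<forall>i<j. digit N u i \<noteq> digit N u j) \<and>
      (\<exists>L<Suc k. fuel c S (prod_encode (m + p * N, list_encode (map (\<lambda>t.
        digit (2 ^ k) w (digit N u (a t)) div 2 ^ q t mod 2) [0..<L]))) k = 2)) :: nat)" for S z
  have "pr e"
    unfolding e_def Let_def
    by (intro pr_intros pr_list_encode pr_digit pr_fuel pr_comp[OF a] pr_comp[OF q])
  then obtain ec where ec: "mufree ec" "\<And>S z. runs S ec z (e S z)" unfolding pr_def by blast
  obtain idx where idx: "enum_code idx = ec" using enum_code_surj[OF ec(1)] by blast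
  have fuel_R: "R n \<sigma>" if "fuel c A (prod_encode (n, str_code \<sigma>)) t = 2" for n \<sigma> t
  proof -
    have "runs A c (prod_encode (n, str_code \<sigma>)) 1" using that by (intro fuel_sound[where t = t]) simp
    with runs_deterministic[OF c] have "of_bool (R n \<sigma>) = (1 :: nat)" .
    then show ?thesis by (cases "R n \<sigma>") simp_all
  qed
  have digits_inj: "(\<forall>j<p. \<forall>i<j. digit N u i \<noteq> digit N u j) \<longleftrightarrow> inj_on (digit N u) {..<p}" for N u
  proof
    assume "\<forall>j<p. \<forall>i<j. digit N u i \<noteq> digit N u j"
    then show "inj_on (digit N u) {..<p}" by (intro linorder_inj_onI') auto
  next
    assume "inj_on (digit N u) {..<p}"
    then show "\<forall>j<p. \<forall>i<j. digit N u i \<noteq> digit N u j" by (fastforce dest: inj_onD)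
  qed
  have mem: "prod_encode (N, prod_encode (k, undigits (2 ^ k) N (\<lambda>i. x i mod 2 ^ k))) \<in> component A ec m \<longleftrightarrow>
      (\<exists>u<N ^ p. inj_on (digit N u) {..<p} \<and>
        (\<exists>L\<le>k. fuel c A (prod_encode (m + p * N, str_code (word a q (digit N u) L x))) k = 2))"
    if N: "0 < N" for N k x m
  proof -
    have "list_encode (map (\<lambda>t. digit (2 ^ k) (undigits (2 ^ k) N (\<lambda>i. x i mod 2 ^ k)) (digit N u (a t)) div 2 ^ q t mod 2) [0..<L])
        = str_code (word a q (digit N u) L x)" if "L \<le> k" for u L
    proof -
      have "digit (2 ^ k) (undigits (2 ^ k) N (\<lambda>i. x i mod 2 ^ k)) (digit N u (a t)) = x (digit N u (a t)) mod 2 ^ k" for t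
        using N by (intro digit_undigits) (auto simp: digit_less)
      moreover have "q t < k" if "t < L" for t using aq(2)[of t] that \<open>L \<le> k\<close> by simp
      ultimately show ?thesis
        unfolding str_code_map[symmetric] word_def
        by (intro arg_cong[where f = str_code] map_cong refl) (simp add: even_mod_div)
    qed
    then have "e A (prod_encode (m, prod_encode (N, prod_encode (k, undigits (2 ^ k) N (\<lambda>i. x i mod 2 ^ k))))) =
      of_bool (\<exists>u<N ^ p. inj_on (digit N u) {..<p} \<and>
        (\<exists>L\<le>k. fuel c A (prod_encode (m + p * N, str_code (word a q (digit N u) L x))) k = 2))"
      unfolding e_def Let_def digits_inj p1_encode p2_encode less_Suc_eq_le by (simp cong: conj_cong)
    moreover have "y \<in> component A ec m \<longleftrightarrow> e A (prod_encode (m, y)) \<noteq> 0" for y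
    proof -
      have "runs A ec x v \<longleftrightarrow> v = e A x" for x v using ec(2) runs_deterministic by blast
      then show ?thesis by (cases "e A (prod_encode (m, y))") (simp_all add: component_def)
    qed
    ultimately show ?thesis by simp
  qed
  have small: "2 ^ m * card {x \<in> {..<N} \<rightarrow>\<^sub>E {..<2 ^ k}. hit (component A ec m) N k x} \<le> (2 ^ k) ^ N"
    if N: "0 < N" for N k m
  proof -
    let ?C = "{..<N} \<rightarrow>\<^sub>E {..<(2::nat) ^ k}"
    have "{x \<in> ?C. hit (component A ec m) N k x} \<subseteq> {x \<in> ?C. \<exists>u<N ^ p. inj_on (digit N u) {..<p} \<and>
        (\<exists>L\<le>k. R (m + p * N) (word a q (digit N u) L x))}"
      unfolding hit_def mem[OF N] using fuel_R by (auto simp: less_Suc_eq_le) (meson le_trans)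
    moreover have "finite ?C" by (intro finite_PiE) auto
    ultimately have "card {x \<in> ?C. hit (component A ec m) N k x} \<le> card {x \<in> ?C. \<exists>u<N ^ p. inj_on (digit N u) {..<p} \<and>
        (\<exists>L\<le>k. R (m + p * N) (word a q (digit N u) L x))}"
      by (intro card_mono) auto
    also have "2 ^ m * \<dots> \<le> (2 ^ k) ^ N"
      using aq by (intro card_tuples_in_test R N) (simp_all add: p_def)
    finally show ?thesis by simp
  qed
  have "\<forall>i<p. \<exists>Z. Ws ! i = tree_path (random_tree A) Z"
    using Ws(2) nth_mem[of _ Ws] unfolding paths_def p_def by blast
  then obtain Z where Z: "\<And>i. i < p \<Longrightarrow> Ws ! i = tree_path (random_tree A) (Z i)" by metis
  have Z_neq: "Z i \<noteq> Z j" if "i < p" "j < p" "i \<noteq> j" for i j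
    using that Ws(1) Z by (metis nth_eq_iff_index_eq p_def)
  have "\<forall>\<^sub>F N in sequentially. \<forall>i\<in>{..<p}. \<forall>j\<in>{..<p}. i \<noteq> j \<longrightarrow> ancestor (Z i) N \<noteq> ancestor (Z j) N"
    using Z_neq by (intro eventually_ball_finite ballI) (auto intro: ancestor_eventually_neq)
  then obtain N0 where N0: "\<And>N i j. N0 \<le> N \<Longrightarrow> i < p \<Longrightarrow> j < p \<Longrightarrow> i \<noteq> j \<Longrightarrow> ancestor (Z i) N \<noteq> ancestor (Z j) N"
    unfolding eventually_sequentially by (metis lessThan_iff)
  \<comment> \<open>A stage that tries the program \<open>idx\<close> and at which the paths have
    separated.\<close>
  define N where "N = prod_encode (idx, N0 + 2)"
  have N: "N0 \<le> N" "2 \<le> N" using le_prod_encode_2[of "N0 + 2" idx] by (auto simp: N_def)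
  define m where "m = level N + 1 + level N * N"
  have sub: "component A ec m \<subseteq> avoided_next A N"
  proof -
    have N_pos: "0 < N" using N by simp
    have ec_N: "enum_code (p1 N) = ec" by (simp add: N_def idx)
    show ?thesis
      unfolding m_def by (rule component_subset_avoided_next[OF N_pos, of A, unfolded ec_N]) (rule small[OF N_pos])
  qed
  define u where "u = undigits N p (\<lambda>j. ancestor (Z j) N)"
  have u: "u < N ^ p" "\<And>j. j < p \<Longrightarrow> digit N u j = ancestor (Z j) N"
    unfolding u_def using ancestor(2)[OF N(2)] by (auto intro: undigits_less digit_undigits)
  have u_inj: "inj_on (digit N u) {..<p}"
    using u(2) N0[OF N(1)] by (auto simp: inj_on_def)
  have "X \<in> U (m + p * N)" using X_in by (auto simp: X_def)
  then obtain L where L: "R (m + p * N) (initseg X L)" unfolding U by blast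
  then have "runs A c (prod_encode (m + p * N, str_code (initseg X L))) 1"
    using c[of "m + p * N" "initseg X L"] by simp
  then have "\<forall>\<^sub>F k in sequentially. fuel c A (prod_encode (m + p * N, str_code (initseg X L))) k = Suc 1"
    by (rule fuel_complete)
  then obtain k where k: "fuel c A (prod_encode (m + p * N, str_code (initseg X L))) k = 2" "L \<le> k"
    using eventually_happens'[OF _ eventually_conj[OF _ eventually_ge_at_top[of L]]]
    by (auto simp: numeral_2_eq_2)
  \<comment> \<open>\<open>level M\<close> exceeds \<open>k\<close>, so the strings of stage
    \<open>M\<close> contain all the bits that put the join into the test.\<close>
  define M where "M = max N k"
  have M: "N \<le> M" "k \<le> level M" "2 \<le> M" using N level_gt[of M] by (auto simp: M_def)
  obtain F where F: "\<And>j. j < p \<Longrightarrow> F (ancestor (Z j) N) = ancestor (Z j) M"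
    "\<And>k x. hit (avoided_next A N) N k (x \<circ> F) \<Longrightarrow> hit (avoided_next A M) M k x"
  proof -
    have sep: "ancestor Y K \<noteq> ancestor Y' K"
      if K: "N \<le> K" and Y: "Y \<in> Z ` {..<p}" "Y' \<in> Z ` {..<p}" "Y \<noteq> Y'" for K Y Y'
    proof -
      obtain i j where "Y = Z i" "i < p" "Y' = Z j" "j < p" using Y(1,2) by auto
      with N0[of K i j] N(1) K Y(3) show ?thesis by auto
    qed
    from avoided_descend[of N M "Z ` {..<p}" A, OF N(2) M(1) sep] show ?thesis
      using that by auto
  qed
  \<comment> \<open>The coordinates of the paths at stage \<open>N\<close>, followed by
    \<open>F\<close> to stage \<open>M\<close>, spell an initial segment of the join.\<close>
  have "word a q (digit N u) L (leaf A M \<circ> F) = initseg X L"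
    unfolding word_def initseg_def
  proof (intro map_cong refl)
    fix t assume "t \<in> set [0..<L]"
    then have "q t < level M" using aq(2)[of t] k(2) M(2) by simp
    then show "odd ((leaf A M \<circ> F) (digit N u (a t)) div 2 ^ q t) = X t"
      using tree_path_bit[OF M(3)] aq(1)[of t] by (simp add: X_def Z u(2) F(1) p_def[symmetric])
  qed
  then have "prod_encode (N, prod_encode (k, undigits (2 ^ k) N (\<lambda>i. (leaf A M \<circ> F) i mod 2 ^ k))) \<in> component A ec m"
    unfolding mem[OF less_le_trans[OF zero_less_numeral N(2)]] using u(1) u_inj k by metis
  then have "hit (component A ec m) N (level M) (leaf A M \<circ> F)"
    unfolding hit_def using M(2) by (auto simp: less_Suc_eq_le)
  then have "hit (avoided_next A M) M (level M) (leaf A M)" using F(2) hit_mono[OF sub] by blast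
  then show False using leaf_not_hit_next[of M A] M(3) by simp
qed

theorem theorem7p5:
  fixes A :: "nat set"
  shows "\<exists>T. perfect_tree T \<and> computable_tree (jump A) T \<and>
    (\<forall>Ys. Ys \<noteq> [] \<and> distinct Ys \<and> set Ys \<subseteq> paths T \<longrightarrow> ml_random A (seq_join Ys)) \<and>
    (\<forall>Ys Zs. Ys \<noteq> [] \<and> distinct Ys \<and> set Ys \<subseteq> paths T \<and>
             Zs \<noteq> [] \<and> distinct Zs \<and> set Zs \<subseteq> paths T \<and> set Ys \<inter> set Zs = {} \<longrightarrow>
       mutually_ml_random A (seq_join Ys) (seq_join Zs))"
proof (intro exI conjI allI impI)
  show "perfect_tree (random_tree A)" by (rule perfect_random_tree)
  show "computable_tree (jump A) (random_tree A)" by (rule computable_random_tree)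
next
  fix Ys assume Ys: "Ys \<noteq> [] \<and> distinct Ys \<and> set Ys \<subseteq> paths (random_tree A)"
  let ?p = "length Ys"
  have "inj (\<lambda>t. (t mod ?p, t div ?p))"
    by (rule injI) (metis div_mult_mod_eq prod.inject)
  then show "ml_random A (seq_join Ys)"
    unfolding seq_join_def using Ys
    by (intro ml_random_join[where a = "\<lambda>t. t mod ?p" and q = "\<lambda>t. t div ?p"]) (auto intro: pr_intros)
next
  fix Ys Zs
  assume YZ: "Ys \<noteq> [] \<and> distinct Ys \<and> set Ys \<subseteq> paths (random_tree A) \<and>
    Zs \<noteq> [] \<and> distinct Zs \<and> set Zs \<subseteq> paths (random_tree A) \<and> set Ys \<inter> set Zs = {}"
  let ?y = "length Ys" and ?z = "length Zs"
  \<comment> \<open>Even times read the paths of \<open>Ys\<close>, odd times those of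
    \<open>Zs\<close>, which follow them in \<open>Ys @ Zs\<close>.\<close>
  define a where "a t = (if t mod 2 = 0 then t div 2 mod ?y else ?y + t div 2 mod ?z)" for t
  define q where "q t = t div 2 div (if t mod 2 = 0 then ?y else ?z)" for t
  have pos: "0 < ?y" "0 < ?z" using YZ by auto
  have "inj (\<lambda>t. (a t, q t))"
  proof (rule injI)
    fix s t assume eq: "(a s, q s) = (a t, q t)"
    have a_less: "a t < ?y \<longleftrightarrow> t mod 2 = 0" for t using pos by (simp add: a_def)
    then have "s mod 2 = t mod 2" using eq by (metis not_mod_2_eq_0_eq_1 prod.inject)
    moreover have "s div 2 = t div 2"
    proof (cases "t mod 2 = 0")
      case True
      then have "s div 2 mod ?y = t div 2 mod ?y" "s div 2 div ?y = t div 2 div ?y"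
        using eq \<open>s mod 2 = t mod 2\<close> by (simp_all add: a_def q_def)
      then show ?thesis by (metis div_mult_mod_eq)
    next
      case False
      then have "s div 2 mod ?z = t div 2 mod ?z" "s div 2 div ?z = t div 2 div ?z"
        using eq \<open>s mod 2 = t mod 2\<close> by (simp_all add: a_def q_def)
      then show ?thesis by (metis div_mult_mod_eq)
    qed
    ultimately show "s = t" by (metis div_mult_mod_eq)
  qed
  moreover have "pr (\<lambda>S. a)" "pr (\<lambda>S. q)" unfolding a_def q_def by (intro pr_intros)+
  moreover have "a t < length (Ys @ Zs)" for t
    using pos by (auto simp: a_def intro: trans_less_add1)
  moreover have "q t \<le> t" for t unfolding q_def by (metis div_le_dividend le_trans)
  ultimately have "ml_random A (\<lambda>t. ((Ys @ Zs) ! a t) (q t))"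
    using YZ by (intro ml_random_join) auto
  moreover have "seq_join [seq_join Ys, seq_join Zs] = (\<lambda>t. ((Ys @ Zs) ! a t) (q t))"
  proof
    fix t
    show "seq_join [seq_join Ys, seq_join Zs] t = ((Ys @ Zs) ! a t) (q t)"
      using pos by (cases "t mod 2 = 0") (auto simp: seq_join_def a_def q_def nth_append numeral_2_eq_2[symmetric])
  qed
  ultimately show "mutually_ml_random A (seq_join Ys) (seq_join Zs)"
    unfolding mutually_ml_random_def by simp
qed

end
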